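(* Let Condition $\mathcal R$ (stated in the context) be fulfilled. Then for any function $h(\cdot)\in\mathcal H_r$, where $$ \mathcal H_r=\left\{h(\cdot):\ \left\|\frac{h(x_\cdot)\,\sigma(x_\cdot)^2}{S_0(x_\cdot)}\right\|\ge\frac r\varepsilon\right\}, $$ the power function of the test $1_{\{\delta_\varepsilon>c_\alpha\}}$ satisfies, as $\varepsilon\to0$, $$ \beta(\delta_\varepsilon,h)=\mathbf P_h\{\delta_\varepsilon>c_\alpha\}=\mathbf P\left\{\int_0^1\left[\int_0^v h_*(s)\,\mathrm ds+w_v\right]^2\mathrm dv>c_\alpha\right\}+o(1), $$ where $w_v$, $0\le v\le1$, is a standard Wiener process and $h_*(s)=u_T^{1/2}\,h\big(x(u_Ts)\big)$, $0\le s\le1$. The remaining notation is defined in the context.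
   Context: Fix $T>0$, $r>0$, $\alpha\in(0,1)$ and a deterministic $x_0\in\mathbb R$. The functions $S_0$ and $\sigma$ are known, $\sigma(\cdot)^2>0$, and for some $L>0$, $|S_0(x)-S_0(y)|+|\sigma(x)-\sigma(y)|\le L|x-y|$ for all $x,y$. The function $x_t$, $0\le t\le T$, is the solution of $\frac{\mathrm dx_t}{\mathrm dt}=S_0(x_t)$ with initial value $x_0$. The norm $\|\cdot\|$ is the $\mathcal L_2(0,T)$-norm in $t$, i.e. $\|g(x_\cdot)\|^2=\int_0^T g(x_t)^2\,\mathrm dt$, with $x_t$ the solution just defined (under the basic hypothesis). Condition $\mathcal R$: $S_0$ has two continuous bounded derivatives $S_0',S_0''$, $\sigma$ has one continuous bounded derivative $\sigma'$, and $S_0(x)>0$, $\sigma^2(x)>0$ for $x\ge x_0$. Observations: for a function $h(\cdot)$, $\mathbf P_h$ denotes the probability under which the observed process $X^\varepsilon=\{X_t,\,0\le t\le T\}$ satisfies $$\mathrm dX_t=S_0(X_t)\,\mathrm dt+\varepsilon\,\frac{h(X_t)\,\sigma(X_t)^2}{S_0(X_t)}\,\mathrm dt+\varepsilon\,\sigma(X_t)\,\mathrm dW_t,\qquad X_0=x_0,\quad 0\le t\le T,$$ with $W$ a Wiener process; $h\equiv0$ corresponds to the basic hypothesis. Under alternatives, the trend coefficient $S=S_0+\varepsilon h\sigma^2/S_0$ and $\sigma$ are supposed to satisfy $|S(x)-S(y)|+|\sigma(x)-\sigma(y)|\le L|x-y|$ and $|S(x)|+|\sigma(x)|\le L(1+|x|)$.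 Test statistic and threshold: $$ \delta_\varepsilon=\left[\int_0^T\left(\frac{\sigma(x_t)}{S_0(x_t)}\right)^2\mathrm dt\right]^{-2}\int_0^T\left(\frac{X_t-x_t}{\varepsilon\,S_0(x_t)^2}\right)^2\sigma(x_t)^2\,\mathrm dt , $$ and $c_\alpha$ is the solution of $\mathbf P\{\int_0^1 w_v^2\,\mathrm dv>c_\alpha\}=\alpha$. Put $u(x)=\int_{x_0}^x\frac{\sigma(y)^2}{S_0(y)^3}\,\mathrm dy$ for $x\in[x_0,x_T]$, $u_T=u(x_T)$, and let $x(u)$, $u\in[0,u_T]$, be the function inverse to $u(x)$. *)

theory Defs
  imports "HOL-Probability.Probability"
begin

definition wiener_process :: "'a measure \<Rightarrow> real \<Rightarrow> (real \<Rightarrow> 'a \<Rightarrow> real) \<Rightarrow> bool" where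
  "wiener_process M T W \<longleftrightarrow>
     prob_space M \<and>
     (\<forall>t\<in>{0..T}. W t \<in> borel_measurable M) \<and>
     (\<forall>\<omega>\<in>space M. W 0 \<omega> = 0) \<and>
     (\<forall>\<omega>\<in>space M. continuous_on {0..T} (\<lambda>t. W t \<omega>)) \<and>
     (\<forall>s t. 0 \<le> s \<and> s < t \<and> t \<le> T \<longrightarrow>
        distributed M lborel (\<lambda>\<omega>. W t \<omega> - W s \<omega>) (normal_density 0 (sqrt (t - s)))) \<and>
     (\<forall>(n::nat) \<tau>. 0 \<le> \<tau> 0 \<and> (\<forall>i<n. \<tau> i < \<tau> (Suc i)) \<and> \<tau> n \<le> T \<longrightarrow>
        prob_space.indep_vars M (\<lambda>_. borel) (\<lambda>i \<omega>. W (\<tau> (Suc i)) \<omega> - W (\<tau> i) \<omega>) {..<n})"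

text \<open>Only the sigma-algebras \<open>F t\<close> with \<open>0 \<le> t \<le> T\<close> matter; indices outside \<open>{0..T}\<close> are there
  because the library's filtrations are indexed by a whole type. No completeness or
  right-continuity of the filtration is required.\<close>

definition wiener_process_wrt ::
    "'a measure \<Rightarrow> (real \<Rightarrow> 'a measure) \<Rightarrow> real \<Rightarrow> (real \<Rightarrow> 'a \<Rightarrow> real) \<Rightarrow> bool" where
  "wiener_process_wrt M F T W \<longleftrightarrow>
     wiener_process M T W \<and>
     filtration (space M) F \<and> (\<forall>t. subalgebra M (F t)) \<and>
     (\<forall>t\<in>{0..T}. W t \<in> borel_measurable (F t)) \<and>
     (\<forall>s t. 0 \<le> s \<and> s < t \<and> t \<le> T \<longrightarrow>
        prob_space.indep_set M (sets (F s))
          (sets (vimage_algebra (space M) (\<lambda>\<omega>. W t \<omega> - W s \<omega>) borel)))"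

text \<open>Simple integrands \<open>\<Sum>i<n. \<xi> i \<cdot> 1_{(\<tau> i, \<tau> (i+1)]}\<close> with \<open>\<xi> i\<close> bounded and
  \<open>F (\<tau> i)\<close>-measurable.\<close>

definition simple_integrand ::
    "'a measure \<Rightarrow> (real \<Rightarrow> 'a measure) \<Rightarrow> real \<Rightarrow> nat \<Rightarrow> (nat \<Rightarrow> real) \<Rightarrow> (nat \<Rightarrow> 'a \<Rightarrow> real) \<Rightarrow> bool"
  where
  "simple_integrand M F T n \<tau> \<xi> \<longleftrightarrow>
     \<tau> 0 = 0 \<and> \<tau> n = T \<and> (\<forall>i<n. \<tau> i < \<tau> (Suc i)) \<and>
     (\<forall>i<n. \<xi> i \<in> borel_measurable (F (\<tau> i)) \<and> (\<exists>B. \<forall>\<omega>\<in>space M. \<bar>\<xi> i \<omega>\<bar> \<le> B))"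

definition simple_process ::
    "nat \<Rightarrow> (nat \<Rightarrow> real) \<Rightarrow> (nat \<Rightarrow> 'a \<Rightarrow> real) \<Rightarrow> real \<Rightarrow> 'a \<Rightarrow> real" where
  "simple_process n \<tau> \<xi> t \<omega> = (\<Sum>i<n. \<xi> i \<omega> * indicator {\<tau> i<..\<tau> (Suc i)} t)"

definition simple_integral ::
    "(real \<Rightarrow> 'a \<Rightarrow> real) \<Rightarrow> nat \<Rightarrow> (nat \<Rightarrow> real) \<Rightarrow> (nat \<Rightarrow> 'a \<Rightarrow> real) \<Rightarrow> real \<Rightarrow> 'a \<Rightarrow> real" where
  "simple_integral W n \<tau> \<xi> t \<omega> =
     (\<Sum>i<n. \<xi> i \<omega> * (W (min t (\<tau> (Suc i))) \<omega> - W (min t (\<tau> i)) \<omega>))"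

text \<open>\<open>is_ito_integral M F T W H I\<close>: the process \<open>I\<close> is a continuous version of
  \<open>t \<mapsto> \<integral>\<^sub>0\<^sup>t H\<^sub>s dW\<^sub>s\<close> on \<open>{0..T}\<close>, for progressively measurable \<open>H\<close> with
  \<open>\<integral>\<^sub>0\<^sup>T H\<^sub>s\<^sup>2 ds < \<infinity>\<close> almost surely, i.e. the limit in probability of the integrals of simple
  integrands \<open>H\<^sup>k\<close> such that \<open>\<integral>\<^sub>0\<^sup>T (H\<^sup>k\<^sub>s - H\<^sub>s)\<^sup>2 ds \<rightarrow> 0\<close> in probability. The
  nonnegative integral keeps a divergent \<open>ds\<close>-integral from being read as \<open>0\<close>.\<close>

definition is_ito_integral ::
    "'a measure \<Rightarrow> (real \<Rightarrow> 'a measure) \<Rightarrow> real \<Rightarrow> (real \<Rightarrow> 'a \<Rightarrow> real) \<Rightarrow>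
     (real \<Rightarrow> 'a \<Rightarrow> real) \<Rightarrow> (real \<Rightarrow> 'a \<Rightarrow> real) \<Rightarrow> bool" where
  "is_ito_integral M F T W H I \<longleftrightarrow>
     (\<forall>t\<in>{0..T}. (\<lambda>(s, \<omega>). H s \<omega>) \<in> borel_measurable (restrict_space borel {0..t} \<Otimes>\<^sub>M F t)) \<and>
     (AE \<omega> in M. (\<integral>\<^sup>+s\<in>{0..T}. ennreal ((H s \<omega>)\<^sup>2) \<partial>lborel) < \<infinity>) \<and>
     (\<forall>t\<in>{0..T}. I t \<in> borel_measurable M) \<and>
     (\<forall>\<omega>\<in>space M. continuous_on {0..T} (\<lambda>t. I t \<omega>)) \<and>
     (\<exists>n \<tau> \<xi>.
        (\<forall>k::nat. simple_integrand M F T (n k) (\<tau> k) (\<xi> k)) \<and>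
        (\<forall>e>0. (\<lambda>k. measure M {\<omega>\<in>space M.
            (\<integral>\<^sup>+s\<in>{0..T}. ennreal ((simple_process (n k) (\<tau> k) (\<xi> k) s \<omega> - H s \<omega>)\<^sup>2) \<partial>lborel)
              > ennreal e}) \<longlonglongrightarrow> 0) \<and>
        (\<forall>t\<in>{0..T}. \<forall>e>0. (\<lambda>k. measure M {\<omega>\<in>space M.
            \<bar>simple_integral W (n k) (\<tau> k) (\<xi> k) t \<omega> - I t \<omega>\<bar> > e}) \<longlonglongrightarrow> 0))"

text \<open>\<open>X\<close> solves \<open>dX\<^sub>t = b(X\<^sub>t) dt + a(X\<^sub>t) dW\<^sub>t\<close>, \<open>X\<^sub>0 = x0\<close>, on \<open>{0..T}\<close>.\<close>

definition sde_solution ::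
    "'a measure \<Rightarrow> (real \<Rightarrow> 'a measure) \<Rightarrow> real \<Rightarrow> (real \<Rightarrow> 'a \<Rightarrow> real) \<Rightarrow>
     (real \<Rightarrow> real) \<Rightarrow> (real \<Rightarrow> real) \<Rightarrow> real \<Rightarrow> (real \<Rightarrow> 'a \<Rightarrow> real) \<Rightarrow> bool" where
  "sde_solution M F T W b a x0 X \<longleftrightarrow>
     wiener_process_wrt M F T W \<and>
     (\<forall>t\<in>{0..T}. X t \<in> borel_measurable (F t)) \<and>
     (\<forall>\<omega>\<in>space M. continuous_on {0..T} (\<lambda>t. X t \<omega>)) \<and>
     (\<exists>I. is_ito_integral M F T W (\<lambda>t \<omega>. a (X t \<omega>)) I \<and>
        (AE \<omega> in M. \<forall>t\<in>{0..T}.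
           X t \<omega> = x0 + (LINT s:{0..t}|lborel. b (X s \<omega>)) + I t \<omega>))"

definition condition_R :: "real \<Rightarrow> (real \<Rightarrow> real) \<Rightarrow> (real \<Rightarrow> real) \<Rightarrow> bool" where
  "condition_R x0 S0 \<sigma> \<longleftrightarrow>
     (\<exists>S0' S0''.
        (\<forall>x. (S0 has_real_derivative S0' x) (at x)) \<and>
        (\<forall>x. (S0' has_real_derivative S0'' x) (at x)) \<and>
        continuous_on UNIV S0' \<and> bounded (range S0') \<and>
        continuous_on UNIV S0'' \<and> bounded (range S0'')) \<and>
     (\<exists>\<sigma>'. (\<forall>x. (\<sigma> has_real_derivative \<sigma>' x) (at x)) \<and>
        continuous_on UNIV \<sigma>' \<and> bounded (range \<sigma>')) \<and>
     (\<forall>x\<ge>x0. S0 x > 0 \<and> (\<sigma> x)\<^sup>2 > 0)"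

text \<open>The trend under the alternative \<open>h\<close>. Where \<open>S0 x = 0\<close> (possible only for \<open>x < x0\<close> under
  \<open>condition_R\<close>) the totalised division makes it equal to \<open>S0 x\<close>.\<close>

definition trend :: "(real \<Rightarrow> real) \<Rightarrow> (real \<Rightarrow> real) \<Rightarrow> real \<Rightarrow> (real \<Rightarrow> real) \<Rightarrow> real \<Rightarrow> real" where
  "trend S0 \<sigma> \<epsilon> h x = S0 x + \<epsilon> * (h x * (\<sigma> x)\<^sup>2 / S0 x)"

definition admissible :: "real \<Rightarrow> (real \<Rightarrow> real) \<Rightarrow> (real \<Rightarrow> real) \<Rightarrow> bool" where
  "admissible L S \<sigma> \<longleftrightarrow>
     (\<forall>x y. \<bar>S x - S y\<bar> + \<bar>\<sigma> x - \<sigma> y\<bar> \<le> L * \<bar>x - y\<bar>) \<and>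
     (\<forall>x. \<bar>S x\<bar> + \<bar>\<sigma> x\<bar> \<le> L * (1 + \<bar>x\<bar>))"

definition L2_norm_on :: "real \<Rightarrow> (real \<Rightarrow> real) \<Rightarrow> real" where
  "L2_norm_on T g = sqrt (LINT t:{0..T}|lborel. (g t)\<^sup>2)"

text \<open>In the definitions below, \<open>xs\<close> is the path \<open>t \<mapsto> x\<^sub>t\<close> of the noise-free equation.\<close>

definition alternatives ::
    "real \<Rightarrow> (real \<Rightarrow> real) \<Rightarrow> (real \<Rightarrow> real) \<Rightarrow> (real \<Rightarrow> real) \<Rightarrow> real \<Rightarrow> real \<Rightarrow> (real \<Rightarrow> real) set" where
  "alternatives T S0 \<sigma> xs r \<epsilon> =
     {h. L2_norm_on T (\<lambda>t. h (xs t) * (\<sigma> (xs t))\<^sup>2 / S0 (xs t)) \<ge> r / \<epsilon>}"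

definition test_statistic ::
    "real \<Rightarrow> (real \<Rightarrow> real) \<Rightarrow> (real \<Rightarrow> real) \<Rightarrow> (real \<Rightarrow> real) \<Rightarrow> real \<Rightarrow> (real \<Rightarrow> real) \<Rightarrow> real" where
  "test_statistic T S0 \<sigma> xs \<epsilon> X =
     (LINT t:{0..T}|lborel. (\<sigma> (xs t) / S0 (xs t))\<^sup>2) powi (-2) *
     (LINT t:{0..T}|lborel. ((X t - xs t) / (\<epsilon> * (S0 (xs t))\<^sup>2))\<^sup>2 * (\<sigma> (xs t))\<^sup>2)"

definition u_fun :: "(real \<Rightarrow> real) \<Rightarrow> (real \<Rightarrow> real) \<Rightarrow> real \<Rightarrow> real \<Rightarrow> real" where
  "u_fun S0 \<sigma> x0 x = (LINT y:{x0..x}|lborel. (\<sigma> y)\<^sup>2 / (S0 y)^3)"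

definition h_star ::
    "real \<Rightarrow> (real \<Rightarrow> real) \<Rightarrow> (real \<Rightarrow> real) \<Rightarrow> (real \<Rightarrow> real) \<Rightarrow> real \<Rightarrow> (real \<Rightarrow> real) \<Rightarrow> real \<Rightarrow> real" where
  "h_star T S0 \<sigma> xs x0 h s =
     (let u = u_fun S0 \<sigma> x0; uT = u (xs T)
      in sqrt uT * h (the_inv_into {x0..xs T} u (uT * s)))"

end

theory Submission
  imports Defs
begin

text \<open>
  Under an alternative \<open>h\<close> the trend is \<open>S = S\<^sub>0 + \<epsilon> h \<sigma>\<^sup>2 / S\<^sub>0\<close>, and the lower bound \<open>r / \<epsilon>\<close> on
  \<open>\<parallel>h \<sigma>\<^sup>2 / S\<^sub>0\<parallel>\<close> says that the difference \<open>S - S\<^sub>0\<close> has norm at least \<open>r\<close> along the noise-free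
  path \<open>x\<close>, whatever \<open>\<epsilon>\<close> is. Such alternatives are so far from the hypothesis that both powers tend
  to one; this is how the two sides come to differ by \<open>o(1)\<close>.

  The quantitative core is deterministic. A function that is Lipschitz with a given constant and
  large at one point is large with constant sign on an interval of fixed length, so its primitive
  cannot be close to zero in mean square (\<open>primitive_bounded_below\<close>). Since \<open>S\<close> and \<open>S\<^sub>0\<close> are
  Lipschitz with the same constant for every \<open>\<epsilon>\<close>, this applies uniformly, with two consequences.

  \<^item> For the limit, it applies to \<open>\<epsilon> h\<^sub>*\<close>, which is a constant multiple of a Lipschitz
    reparametrisation of \<open>(S - S\<^sub>0) S\<^sub>0 / \<sigma>\<^sup>2\<close> (\<open>scaled_h_star\<close>, \<open>h_star_gap\<close>). The drift \<open>\<integral>\<^sub>0\<^sup>v h\<^sub>*\<close> therefore has squared norm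
    at least \<open>\<kappa> / \<epsilon>\<^sup>2\<close>, and adding a Wiener process, whose norm is one finite random variable for all \<open>\<epsilon>\<close>,
    cannot bring it below \<open>c\<close> with more than vanishing probability (\<open>limit_power_tendsto_1\<close>).

  \<^item> For the test, acceptance forces \<open>\<integral> (X - x)\<^sup>2 \<le> K \<epsilon>\<^sup>2\<close> (\<open>accepting_forces_near\<close>). On that event the
    equation expresses the primitive of \<open>S(x) - S\<^sub>0(x)\<close> as \<open>X - x\<close> minus a term of order \<open>\<epsilon>\<close> minus
    the Ito integral \<open>I\<close>, so that \<open>I\<close> has to be of order one in mean square
    (\<open>pathwise_lower_bound\<close>). On the same event the quadratic variation of \<open>I\<close> is of order \<open>\<epsilon>\<^sup>2\<close>, since
    \<open>\<sigma>(X)\<close> is controlled by \<open>\<sigma>(x)\<close> and \<open>X - x\<close>. A tail bound for \<open>I\<close> in terms of its quadratic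
    variation (\<open>ito_integral_tail\<close>) makes the event unlikely (\<open>sde_near_unperturbed_path\<close>). Working
    on this event replaces all moment estimates for \<open>X\<close>.
\<close>

section \<open>Continuous functions on an interval and their primitives\<close>

lemma set_lebesgue_integral_continuous:
  fixes f :: "real \<Rightarrow> real"
  assumes "continuous_on {a..b} f"
  shows "(LINT s:{a..b}|lborel. f s) = integral {a..b} f"
  using assms borel_integrable_atLeastAtMost' set_borel_integral_eq_integral(2) by blast

text \<open>On an interval of length \<open>\<delta>\<close> around \<open>t\<^sub>0\<close> the function stays above \<open>\<rho> / 2\<close>, so the primitive
  increases there with slope at least \<open>\<rho> / 2\<close>. Depending on its sign at the midpoint, it exceeds
  \<open>\<rho> \<delta> / 8\<close> in absolute value on the last or on the first quarter of that interval.\<close>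

lemma primitive_bounded_below_pos:
  fixes T \<Lambda> \<rho> :: real
  assumes "T > 0" "\<Lambda> > 0" "\<rho> > 0"
  defines "\<delta> \<equiv> min (T / 2) (\<rho> / (2 * \<Lambda>))"
  assumes lip: "\<And>x y. x \<in> {0..T} \<Longrightarrow> y \<in> {0..T} \<Longrightarrow> \<bar>f x - f y\<bar> \<le> \<Lambda> * \<bar>x - y\<bar>"
    and t0: "t\<^sub>0 \<in> {0..T}" "f t\<^sub>0 \<ge> \<rho>"
  shows "\<delta> / 4 * min ((\<rho> * \<delta> / 8)\<^sup>2) 1 \<le> integral {0..T} (\<lambda>t. min ((integral {0..t} f)\<^sup>2) (1::real))"
proof -
  define G where "G t = integral {0..t} f" for t
  have \<delta>: "\<delta> > 0" "\<delta> \<le> T / 2" "\<Lambda> * \<delta> \<le> \<rho> / 2"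
    using assms(1-3) by (auto simp: \<delta>_def min_def field_simps)
  have "\<Lambda>-lipschitz_on {0..T} f"
    using lip assms(2) by (intro lipschitz_onI) (auto simp: dist_real_def)
  then have cf: "continuous_on {0..T} f"
    by (rule lipschitz_on_continuous_on)
  then have int: "f integrable_on {0..T}"
    by (rule integrable_continuous_interval)
  have cG: "continuous_on {0..T} G"
    unfolding G_def using indefinite_integral_continuous_1[OF int] .
  obtain a where a: "0 \<le> a" "a + \<delta> \<le> T" "t\<^sub>0 \<in> {a..a + \<delta>}"
  proof (cases "t\<^sub>0 + \<delta> \<le> T")
    case True
    then show thesis using t0 \<delta> by (intro that[of t\<^sub>0]) auto
  next
    case False
    then show thesis using t0 \<delta> by (intro that[of "t\<^sub>0 - \<delta>"]) auto
  qed
  have f_ge: "f s \<ge> \<rho> / 2" if "s \<in> {a..a + \<delta>}" for s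
  proof -
    have "\<bar>f s - f t\<^sub>0\<bar> \<le> \<Lambda> * \<bar>s - t\<^sub>0\<bar>" using that a t0 by (intro lip) auto
    also have "\<dots> \<le> \<Lambda> * \<delta>" using that a assms(2) by (intro mult_left_mono) auto
    finally show ?thesis using t0 \<delta> by linarith
  qed
  have slope: "G t - G s \<ge> \<rho> / 2 * (t - s)" if "a \<le> s" "s \<le> t" "t \<le> a + \<delta>" for s t
  proof -
    have "integral {0..s} f + integral {s..t} f = integral {0..t} f"
      using that a by (intro Henstock_Kurzweil_Integration.integral_combine integrable_on_subinterval[OF int]) auto
    moreover have "integral {s..t} (\<lambda>_. \<rho> / 2) \<le> integral {s..t} f"
      using that a f_ge by (intro integral_le integrable_on_subinterval[OF int]) auto
    ultimately show ?thesis using that by (simp add: G_def mult.commute)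
  qed
  obtain p where p: "a \<le> p" "p + \<delta> / 4 \<le> a + \<delta>" "\<And>t. t \<in> {p..p + \<delta> / 4} \<Longrightarrow> \<rho> * \<delta> / 8 \<le> \<bar>G t\<bar>"
  proof (cases "G (a + \<delta> / 2) \<ge> 0")
    case True
    have "\<rho> * \<delta> / 8 \<le> \<bar>G t\<bar>" if "t \<in> {a + \<delta> * 3 / 4..a + \<delta>}" for t
    proof -
      have "\<rho> / 2 * (\<delta> / 4) \<le> \<rho> / 2 * (t - (a + \<delta> / 2))"
        using that assms(3) by (intro mult_left_mono) auto
      also have "\<dots> \<le> G t - G (a + \<delta> / 2)" using that \<delta> by (intro slope) auto
      finally show ?thesis using True by simp
    qed
    then show thesis using \<delta> by (intro that[of "a + \<delta> * 3 / 4"]) auto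
  next
    case False
    have "\<rho> * \<delta> / 8 \<le> \<bar>G t\<bar>" if "t \<in> {a..a + \<delta> / 4}" for t
    proof -
      have "\<rho> / 2 * (\<delta> / 4) \<le> \<rho> / 2 * ((a + \<delta> / 2) - t)"
        using that assms(3) by (intro mult_left_mono) auto
      also have "\<dots> \<le> G (a + \<delta> / 2) - G t" using that \<delta> by (intro slope) auto
      finally show ?thesis using False by simp
    qed
    then show thesis using \<delta> by (intro that[of a]) auto
  qed
  have cm: "continuous_on {0..T} (\<lambda>t. min ((G t)\<^sup>2) 1)"
    by (intro continuous_intros cG)
  have "\<delta> / 4 * min ((\<rho> * \<delta> / 8)\<^sup>2) 1 = integral {p..p + \<delta> / 4} (\<lambda>_. min ((\<rho> * \<delta> / 8)\<^sup>2) 1)"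
    using \<delta> by simp
  also have "\<dots> \<le> integral {p..p + \<delta> / 4} (\<lambda>t. min ((G t)\<^sup>2) 1)"
  proof (rule integral_le)
    show "(\<lambda>t. min ((G t)\<^sup>2) 1) integrable_on {p..p + \<delta> / 4}"
      using p a by (intro integrable_continuous_interval continuous_on_subset[OF cm]) auto
    show "min ((\<rho> * \<delta> / 8)\<^sup>2) 1 \<le> min ((G t)\<^sup>2) 1" if "t \<in> {p..p + \<delta> / 4}" for t
      using power_mono[OF p(3)[OF that], of 2] assms(3) \<delta> by auto
  qed auto
  also have "\<dots> \<le> integral {0..T} (\<lambda>t. min ((G t)\<^sup>2) 1)"
    using p a by (intro integral_subset_le integrable_continuous_interval continuous_on_subset[OF cm] cm) auto
  finally show ?thesis unfolding G_def .
qed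

text \<open>What matters is the order of the quantifiers: \<open>\<kappa>\<close> depends on \<open>T\<close>, the Lipschitz constant and the
  height \<open>\<rho>\<close> only, hence serves all alternatives at once. The primitive is truncated at \<open>1\<close> because
  it is later compared with a truncated Ito integral.\<close>

lemma primitive_bounded_below:
  fixes T \<Lambda> \<rho> :: real
  assumes "T > 0" "\<Lambda> > 0" "\<rho> > 0"
  obtains \<kappa> where "\<kappa> > 0"
    "\<And>f t\<^sub>0. (\<And>x y. x \<in> {0..T} \<Longrightarrow> y \<in> {0..T} \<Longrightarrow> \<bar>f x - f y\<bar> \<le> \<Lambda> * \<bar>x - y\<bar>) \<Longrightarrow>
      t\<^sub>0 \<in> {0..T} \<Longrightarrow> \<rho> \<le> \<bar>f t\<^sub>0\<bar> \<Longrightarrow>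
      \<kappa> \<le> integral {0..T} (\<lambda>t. min ((integral {0..t} f)\<^sup>2) (1::real))"
proof
  define \<delta> where "\<delta> = min (T / 2) (\<rho> / (2 * \<Lambda>))"
  have "\<delta> > 0" using assms by (auto simp: \<delta>_def)
  then show "\<delta> / 4 * min ((\<rho> * \<delta> / 8)\<^sup>2) 1 > 0" using assms by auto
  fix f t\<^sub>0
  assume lip: "\<And>x y. x \<in> {0..T} \<Longrightarrow> y \<in> {0..T} \<Longrightarrow> \<bar>f x - f y\<bar> \<le> \<Lambda> * \<bar>x - y\<bar>"
    and t0: "t\<^sub>0 \<in> {0..T}" "\<rho> \<le> \<bar>f t\<^sub>0\<bar>"
  show "\<delta> / 4 * min ((\<rho> * \<delta> / 8)\<^sup>2) 1 \<le> integral {0..T} (\<lambda>t. min ((integral {0..t} f)\<^sup>2) (1::real))"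
  proof (cases "f t\<^sub>0 \<ge> 0")
    case True
    then show ?thesis
      using primitive_bounded_below_pos[OF assms lip t0(1)] t0 by (auto simp: \<delta>_def)
  next
    case False
    have "\<bar>- f x - - f y\<bar> \<le> \<Lambda> * \<bar>x - y\<bar>" if "x \<in> {0..T}" "y \<in> {0..T}" for x y
      using lip[OF that] by linarith
    from primitive_bounded_below_pos[OF assms this t0(1)] show ?thesis
      using t0 False by (auto simp: \<delta>_def)
  qed
qed

lemma exists_large_value:
  fixes f :: "real \<Rightarrow> real"
  assumes T: "T > 0" and f: "continuous_on {0..T} f" and \<rho>: "\<rho> \<ge> 0"
    and big: "T * \<rho>\<^sup>2 \<le> integral {0..T} (\<lambda>t. (f t)\<^sup>2)"
  obtains t where "t \<in> {0..T}" "\<rho> \<le> \<bar>f t\<bar>"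
proof -
  have cf: "continuous_on {0..T} (\<lambda>t. (f t)\<^sup>2)" using f by (intro continuous_intros)
  then obtain t where t: "t \<in> {0..T}" "\<And>s. s \<in> {0..T} \<Longrightarrow> (f s)\<^sup>2 \<le> (f t)\<^sup>2"
    using continuous_attains_sup[OF compact_Icc _ cf] T by auto
  have "integral {0..T} (\<lambda>t. (f t)\<^sup>2) \<le> integral {0..T} (\<lambda>_. (f t)\<^sup>2)"
    using t(2) by (intro integral_le integrable_continuous_interval cf) auto
  also have "\<dots> = T * (f t)\<^sup>2" using T by simp
  finally have "T * \<rho>\<^sup>2 \<le> T * (f t)\<^sup>2" using big by linarith
  then have "\<rho>\<^sup>2 \<le> (f t)\<^sup>2" using T by simp
  then have "\<rho> \<le> \<bar>f t\<bar>" using \<rho> abs_le_square_iff[of \<rho> "f t"] by simp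
  with t(1) show thesis by (rule that)
qed

lemma positive_continuous_lower_bound:
  fixes f :: "real \<Rightarrow> real"
  assumes "a \<le> b" "continuous_on {a..b} f" "\<And>x. x \<in> {a..b} \<Longrightarrow> f x > 0"
  obtains m where "m > 0" "\<And>x. x \<in> {a..b} \<Longrightarrow> m \<le> f x"
  using continuous_attains_inf[OF compact_Icc _ assms(2)] assms(1,3) by (metis atLeastatMost_empty_iff2 linorder_not_le)

lemma integral_continuous_pos:
  fixes f :: "real \<Rightarrow> real"
  assumes "a < b" "continuous_on {a..b} f" "\<And>x. x \<in> {a..b} \<Longrightarrow> f x > 0"
  shows "integral {a..b} f > 0"
proof -
  obtain m where m: "m > 0" "\<And>x. x \<in> {a..b} \<Longrightarrow> m \<le> f x"
    using positive_continuous_lower_bound[of a b f] assms by auto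
  have "0 < integral {a..b} (\<lambda>_. m)" using assms(1) m(1) by simp
  also have "\<dots> \<le> integral {a..b} f"
    using m(2) by (intro integral_le integrable_continuous_interval assms(2)) auto
  finally show ?thesis .
qed

section \<open>Measurability of time integrals of continuous processes\<close>

text \<open>The process is the pointwise limit of its values at the left endpoints of a grid of mesh
  \<open>T / (n + 1)\<close>, and a process sampled on a countable set of times is jointly measurable.\<close>

lemma continuous_process_jointly_measurable:
  fixes Z :: "real \<Rightarrow> 'a \<Rightarrow> real"
  assumes T: "T > 0"
    and meas: "\<And>t. t \<in> {0..T} \<Longrightarrow> Z t \<in> borel_measurable M"
    and cont: "\<And>\<omega>. \<omega> \<in> space M \<Longrightarrow> continuous_on {0..T} (\<lambda>t. Z t \<omega>)"
  shows "(\<lambda>(t, \<omega>). Z t \<omega>) \<in> borel_measurable (restrict_space borel {0..T} \<Otimes>\<^sub>M M)"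
proof -
  define d where "d n t = T * real (min (nat \<lfloor>real (Suc n) * (t / T)\<rfloor>) (Suc n)) / real (Suc n)" for n t
  have d_mem: "d n t \<in> {0..T}" for n t
    using T by (auto simp: d_def divide_le_eq)
  have d_lim: "(\<lambda>n. d n t) \<longlonglongrightarrow> t" if t: "t \<in> {0..T}" for t
  proof (rule real_tendsto_sandwich)
    show "\<forall>\<^sub>F n in sequentially. t - T / real (Suc n) \<le> d n t"
    proof (intro always_eventually allI)
      fix n
      have "real (Suc n) * (t / T) \<ge> 0" using t T by auto
      moreover have "real (Suc n) * (t / T) \<le> real (Suc n)"
        using t T by (intro mult_left_le) auto
      ultimately have "real (min (nat \<lfloor>real (Suc n) * (t / T)\<rfloor>) (Suc n)) \<ge> real (Suc n) * (t / T) - 1"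
        by linarith
      then have "T / real (Suc n) * (real (Suc n) * (t / T) - 1)
          \<le> T / real (Suc n) * real (min (nat \<lfloor>real (Suc n) * (t / T)\<rfloor>) (Suc n))"
        using T by (intro mult_left_mono) auto
      moreover have "T / real (Suc n) * (real (Suc n) * (t / T) - 1) = t - T / real (Suc n)"
        using T by (simp add: field_simps del: of_nat_Suc)
      ultimately show "t - T / real (Suc n) \<le> d n t" by (simp add: d_def)
    qed
    show "\<forall>\<^sub>F n in sequentially. d n t \<le> t"
    proof (intro always_eventually allI)
      fix n
      have "real (Suc n) * (t / T) \<ge> 0" using t T by auto
      then have "real (min (nat \<lfloor>real (Suc n) * (t / T)\<rfloor>) (Suc n)) \<le> real (Suc n) * (t / T)"
        by linarith
      then have "T / real (Suc n) * real (min (nat \<lfloor>real (Suc n) * (t / T)\<rfloor>) (Suc n))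
          \<le> T / real (Suc n) * (real (Suc n) * (t / T))"
        using T by (intro mult_left_mono) auto
      moreover have "T / real (Suc n) * (real (Suc n) * (t / T)) = t"
        using T by (simp add: field_simps del: of_nat_Suc)
      ultimately show "d n t \<le> t" by (simp add: d_def)
    qed
    have "(\<lambda>n. T / real (Suc n)) \<longlonglongrightarrow> 0"
      using LIMSEQ_Suc[OF lim_const_over_n[of T]] by simp
    from tendsto_diff[OF tendsto_const[of t] this]
    show "(\<lambda>n. t - T / real (Suc n)) \<longlonglongrightarrow> t" by simp
  qed auto
  show ?thesis
  proof (rule borel_measurable_LIMSEQ_real)
    fix p assume "p \<in> space (restrict_space borel {0..T} \<Otimes>\<^sub>M M)"
    then obtain t \<omega> where p: "p = (t, \<omega>)" "t \<in> {0..T}" "\<omega> \<in> space M"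
      by (auto simp: space_pair_measure space_restrict_space)
    have "(\<lambda>n. Z (d n t) \<omega>) \<longlonglongrightarrow> Z t \<omega>"
      by (rule continuous_on_tendsto_compose[OF cont[OF p(3)] d_lim[OF p(2)] p(2)])
        (use d_mem in auto)
    then show "(\<lambda>n. (\<lambda>(t, \<omega>). Z (d n t) \<omega>) p) \<longlonglongrightarrow> (\<lambda>(t, \<omega>). Z t \<omega>) p"
      by (simp add: p)
  next
    fix n
    have *: "(\<lambda>p. Z (T * real (min k (Suc n)) / real (Suc n)) (snd p))
        \<in> borel_measurable (restrict_space borel {0..T} \<Otimes>\<^sub>M M)" for k
    proof -
      have "T * real (min k (Suc n)) / real (Suc n) \<in> {0..T}"
        using T by (auto simp: divide_le_eq)
      from meas[OF this] show ?thesis by measurable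
    qed
    have **: "(\<lambda>p. nat \<lfloor>real (Suc n) * (fst p / T)\<rfloor>)
        \<in> measurable (restrict_space borel {0..T} \<Otimes>\<^sub>M M) (count_space UNIV)"
    proof -
      have "fst \<in> borel_measurable (restrict_space borel {0..T} \<Otimes>\<^sub>M M)"
        by (rule measurable_compose[OF measurable_fst]) (simp add: measurable_restrict_space1)
      then show ?thesis by measurable
    qed
    show "(\<lambda>(t, \<omega>). Z (d n t) \<omega>) \<in> borel_measurable (restrict_space borel {0..T} \<Otimes>\<^sub>M M)"
      using measurable_compose_countable[OF * **] by (simp add: d_def case_prod_beta)
  qed
qed

lemma sigma_finite_lborel_Icc: "sigma_finite_measure (restrict_space lborel {0..T::real})"
  by (intro sigma_finite_measure_restrict_space lborel.sigma_finite_measure_axioms) auto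

lemma measurable_pair_swap_Icc:
  assumes "(\<lambda>(s, \<omega>). f s \<omega>) \<in> borel_measurable (restrict_space borel {0..T::real} \<Otimes>\<^sub>M M)"
  shows "(\<lambda>(\<omega>, s). f s \<omega>) \<in> borel_measurable (M \<Otimes>\<^sub>M restrict_space lborel {0..T})"
proof -
  have "sets (restrict_space borel {0..T} \<Otimes>\<^sub>M M) = sets (restrict_space lborel {0..T} \<Otimes>\<^sub>M M)"
    by (intro sets_pair_measure_cong sets_restrict_space_cong) auto
  then have "(\<lambda>(s, \<omega>). f s \<omega>) \<in> borel_measurable (restrict_space lborel {0..T} \<Otimes>\<^sub>M M)"
    using assms by (simp cong: measurable_cong_sets)
  from measurable_pair_swap[OF this] show ?thesis by (simp add: case_prod_beta)
qed

lemma borel_measurable_nn_integral_time: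
  fixes f :: "real \<Rightarrow> 'a \<Rightarrow> ennreal"
  assumes "(\<lambda>(s, \<omega>). f s \<omega>) \<in> borel_measurable (restrict_space borel {0..T::real} \<Otimes>\<^sub>M M)"
  shows "(\<lambda>\<omega>. \<integral>\<^sup>+s\<in>{0..T}. f s \<omega> \<partial>lborel) \<in> borel_measurable M"
proof -
  interpret Q: sigma_finite_measure "restrict_space lborel {0..T}" by (rule sigma_finite_lborel_Icc)
  have "(\<lambda>\<omega>. \<integral>\<^sup>+s. f s \<omega> \<partial>restrict_space lborel {0..T}) \<in> borel_measurable M"
    using measurable_pair_swap_Icc[OF assms] by (intro Q.borel_measurable_nn_integral) simp
  then show ?thesis by (simp add: nn_integral_restrict_space)
qed

lemma borel_measurable_set_integral_time:
  fixes f :: "real \<Rightarrow> 'a \<Rightarrow> real"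
  assumes "(\<lambda>(s, \<omega>). f s \<omega>) \<in> borel_measurable (restrict_space borel {0..T::real} \<Otimes>\<^sub>M M)"
  shows "(\<lambda>\<omega>. LINT s:{0..T}|lborel. f s \<omega>) \<in> borel_measurable M"
proof -
  interpret Q: sigma_finite_measure "restrict_space lborel {0..T}" by (rule sigma_finite_lborel_Icc)
  have "(\<lambda>\<omega>. LINT s|restrict_space lborel {0..T}. f s \<omega>) \<in> borel_measurable M"
    using measurable_pair_swap_Icc[OF assms] by (intro Q.borel_measurable_lebesgue_integral) simp
  then show ?thesis by (simp add: integral_restrict_space set_lebesgue_integral_def)
qed

section \<open>A tail bound for the Ito integral\<close>

lemma power2_le_of_abs_le: "\<bar>x\<bar> \<le> B \<Longrightarrow> x\<^sup>2 \<le> B\<^sup>2" for x B :: real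
  using power_mono[of "\<bar>x\<bar>" B 2] by simp

text \<open>The cross term vanishes: \<open>Y \<zeta>\<close> belongs to the past \<open>G\<close>, while \<open>\<Delta>\<close> is centred and independent of \<open>G\<close>.\<close>

lemma (in prob_space) martingale_step_second_moment:
  fixes Y \<zeta> \<Delta> :: "'a \<Rightarrow> real"
  assumes sub: "subalgebra M G"
    and indep: "indep_set (sets G) (sets (vimage_algebra (space M) \<Delta> borel))"
    and Y: "Y \<in> borel_measurable G" "integrable M (\<lambda>\<omega>. (Y \<omega>)\<^sup>2)"
    and \<zeta>: "\<zeta> \<in> borel_measurable G" "\<And>\<omega>. \<omega> \<in> space M \<Longrightarrow> \<bar>\<zeta> \<omega>\<bar> \<le> B"
    and \<Delta>: "\<Delta> \<in> borel_measurable M" "integrable M (\<lambda>\<omega>. (\<Delta> \<omega>)\<^sup>2)" "expectation \<Delta> = 0"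
  shows "integrable M (\<lambda>\<omega>. (Y \<omega> + \<zeta> \<omega> * \<Delta> \<omega>)\<^sup>2)"
    and "expectation (\<lambda>\<omega>. (Y \<omega> + \<zeta> \<omega> * \<Delta> \<omega>)\<^sup>2) =
      expectation (\<lambda>\<omega>. (Y \<omega>)\<^sup>2) + expectation (\<lambda>\<omega>. (\<zeta> \<omega>)\<^sup>2) * expectation (\<lambda>\<omega>. (\<Delta> \<omega>)\<^sup>2)"
proof -
  have YM[measurable]: "Y \<in> borel_measurable M" and \<zeta>M[measurable]: "\<zeta> \<in> borel_measurable M"
    and [measurable]: "\<Delta> \<in> borel_measurable M"
    using measurable_from_subalg[OF sub] Y \<zeta> \<Delta> by auto
  have indep_var: "indep_var borel U borel (\<lambda>\<omega>. g (\<Delta> \<omega>))"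
    if U: "U \<in> borel_measurable G" and g: "g \<in> borel_measurable borel" for U and g :: "real \<Rightarrow> real"
    unfolding indep_var_eq
  proof (intro conjI)
    show UM: "random_variable borel U" using measurable_from_subalg[OF sub U] .
    show gM: "random_variable borel (\<lambda>\<omega>. g (\<Delta> \<omega>))" using g by measurable
    have 1: "sigma_sets (space M) {U -` A \<inter> space M |A. A \<in> sets borel} \<subseteq> sets G"
    proof -
      have "{U -` A \<inter> space G |A. A \<in> sets borel} \<subseteq> sets G" using U by (auto intro: measurable_sets)
      from sets.sigma_sets_subset[OF this] show ?thesis using sub by (simp add: subalgebra_def)
    qed
    have 2: "sigma_sets (space M) {(\<lambda>\<omega>. g (\<Delta> \<omega>)) -` A \<inter> space M |A. A \<in> sets borel}
        \<subseteq> sets (vimage_algebra (space M) \<Delta> borel)"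
    proof -
      have "(\<lambda>\<omega>. g (\<Delta> \<omega>)) -` A \<inter> space M \<in> sets (vimage_algebra (space M) \<Delta> borel)"
        if "A \<in> sets borel" for A :: "real set"
      proof -
        have "(\<lambda>\<omega>. g (\<Delta> \<omega>)) -` A \<inter> space M = \<Delta> -` (g -` A \<inter> space borel) \<inter> space M" by auto
        then show ?thesis using in_vimage_algebra[OF measurable_sets[OF g that]] by simp
      qed
      then have "{(\<lambda>\<omega>. g (\<Delta> \<omega>)) -` A \<inter> space M |A. A \<in> sets borel}
          \<subseteq> sets (vimage_algebra (space M) \<Delta> borel)" by blast
      from sets.sigma_sets_subset[OF this] show ?thesis by simp
    qed
    show "indep_set (sigma_sets (space M) {U -` A \<inter> space M |A. A \<in> sets borel})
        (sigma_sets (space M) {(\<lambda>\<omega>. g (\<Delta> \<omega>)) -` A \<inter> space M |A. A \<in> sets borel})"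
      using indep 1 2 unfolding indep_sets2_eq by blast
  qed
  have intD: "integrable M \<Delta>"
    using \<Delta>(1,2) by (rule square_integrable_imp_integrable)
  have intY: "integrable M Y"
    using YM Y(2) by (rule square_integrable_imp_integrable)
  have intYz: "integrable M (\<lambda>\<omega>. Y \<omega> * \<zeta> \<omega>)"
  proof (rule Bochner_Integration.integrable_bound)
    show "integrable M (\<lambda>\<omega>. B * Y \<omega>)" using intY by simp
    show "AE \<omega> in M. norm (Y \<omega> * \<zeta> \<omega>) \<le> norm (B * Y \<omega>)"
    proof (rule AE_I2)
      fix \<omega> assume "\<omega> \<in> space M"
      from \<zeta>(2)[OF this] show "norm (Y \<omega> * \<zeta> \<omega>) \<le> norm (B * Y \<omega>)"
        using mult_right_mono[of "\<bar>\<zeta> \<omega>\<bar>" "\<bar>B\<bar>" "\<bar>Y \<omega>\<bar>"] by (simp add: abs_mult mult.commute)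
    qed
  qed measurable
  have intz: "integrable M (\<lambda>\<omega>. (\<zeta> \<omega>)\<^sup>2)"
  proof (rule integrable_const_bound[where B = "B\<^sup>2"])
    show "AE \<omega> in M. norm ((\<zeta> \<omega>)\<^sup>2) \<le> B\<^sup>2"
      using \<zeta>(2) by (intro AE_I2) (simp add: power2_le_of_abs_le)
  qed measurable
  have iv1: "indep_var borel (\<lambda>\<omega>. Y \<omega> * \<zeta> \<omega>) borel \<Delta>"
    using indep_var[OF borel_measurable_times[OF Y(1) \<zeta>(1)] measurable_ident] by simp
  have iv2: "indep_var borel (\<lambda>\<omega>. (\<zeta> \<omega>)\<^sup>2) borel (\<lambda>\<omega>. (\<Delta> \<omega>)\<^sup>2)"
    by (rule indep_var[OF borel_measurable_power[OF \<zeta>(1)] borel_measurable_power[OF measurable_ident_sets[OF refl]]])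
  have eq: "(\<lambda>\<omega>. (Y \<omega> + \<zeta> \<omega> * \<Delta> \<omega>)\<^sup>2) =
      (\<lambda>\<omega>. (Y \<omega>)\<^sup>2 + 2 * (Y \<omega> * \<zeta> \<omega> * \<Delta> \<omega>) + (\<zeta> \<omega>)\<^sup>2 * (\<Delta> \<omega>)\<^sup>2)"
    by (auto simp: power2_eq_square algebra_simps)
  note i1 = indep_var_integrable[OF iv1 intYz intD] and i2 = indep_var_integrable[OF iv2 intz \<Delta>(2)]
  show "integrable M (\<lambda>\<omega>. (Y \<omega> + \<zeta> \<omega> * \<Delta> \<omega>)\<^sup>2)"
    unfolding eq using Y(2) i1 i2 by (intro Bochner_Integration.integrable_add) auto
  show "expectation (\<lambda>\<omega>. (Y \<omega> + \<zeta> \<omega> * \<Delta> \<omega>)\<^sup>2) =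
      expectation (\<lambda>\<omega>. (Y \<omega>)\<^sup>2) + expectation (\<lambda>\<omega>. (\<zeta> \<omega>)\<^sup>2) * expectation (\<lambda>\<omega>. (\<Delta> \<omega>)\<^sup>2)"
    unfolding eq using Y(2) i1 i2 \<Delta>(3)
      indep_var_lebesgue_integral[OF iv1 intYz intD] indep_var_lebesgue_integral[OF iv2 intz \<Delta>(2)]
    by simp
qed

lemma wiener_increment_moments:
  assumes "wiener_process M T W" "0 \<le> s" "s < t" "t \<le> T"
  shows "integrable M (\<lambda>\<omega>. (W t \<omega> - W s \<omega>)\<^sup>2)"
    and "(LINT \<omega>|M. W t \<omega> - W s \<omega>) = 0"
    and "(LINT \<omega>|M. (W t \<omega> - W s \<omega>)\<^sup>2) = t - s"
proof -
  interpret prob_space M using assms(1) by (simp add: wiener_process_def)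
  have D: "distributed M lborel (\<lambda>\<omega>. W t \<omega> - W s \<omega>) (normal_density 0 (sqrt (t - s)))"
    using assms by (simp add: wiener_process_def)
  have pos: "sqrt (t - s) > 0" using assms by simp
  show E: "(LINT \<omega>|M. W t \<omega> - W s \<omega>) = 0"
    using normal_distributed_expectation[OF pos D] .
  show "(LINT \<omega>|M. (W t \<omega> - W s \<omega>)\<^sup>2) = t - s"
    using normal_distributed_variance[OF pos D] assms E by simp
  have "integrable lborel (\<lambda>x. normal_density 0 (sqrt (t - s)) x * (x - 0)\<^sup>2)"
    using integrable_normal_moment[OF pos] .
  then show "integrable M (\<lambda>\<omega>. (W t \<omega> - W s \<omega>)\<^sup>2)"
    using distributed_integrable[OF D, of "\<lambda>x. x\<^sup>2"] by simp
qed

lemma borel_measurable_filtration_mono: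
  assumes "filtration \<Omega> F" "s \<le> t" "f \<in> borel_measurable (F s)"
  shows "f \<in> borel_measurable (F t)"
  using assms filtration.sets_F_mono[OF assms(1,2)]
  by (intro measurable_from_subalg[of "F t" "F s"]) (auto simp: subalgebra_def filtration.space_F)

lemma grid_mono:
  fixes \<tau> :: "nat \<Rightarrow> real"
  assumes "\<And>i. i < n \<Longrightarrow> \<tau> i < \<tau> (Suc i)" "i \<le> j" "j \<le> n"
  shows "\<tau> i \<le> \<tau> j"
  using assms(2,3)
proof (induction j)
  case (Suc j)
  then show ?case using assms(1)[of j] by (cases "i = Suc j") auto
qed simp

text \<open>Half of the Ito isometry. Stopping the integral at \<open>t\<close> only shortens the increments, which is why
  equality is lost.\<close>

lemma simple_integral_second_moment:
  assumes W: "wiener_process_wrt M F T W" and t: "t \<in> {0..T}"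
    and \<xi>: "simple_integrand M F T n \<tau> \<xi>"
  shows "integrable M (\<lambda>\<omega>. (simple_integral W n \<tau> \<xi> t \<omega>)\<^sup>2)"
    and "(LINT \<omega>|M. (simple_integral W n \<tau> \<xi> t \<omega>)\<^sup>2)
      \<le> (LINT \<omega>|M. (\<Sum>i<n. (\<xi> i \<omega>)\<^sup>2 * (\<tau> (Suc i) - \<tau> i)))"
proof -
  have wp: "wiener_process M T W" and filt: "filtration (space M) F"
    and sub: "\<And>t. subalgebra M (F t)"
    and WF: "\<And>t. t \<in> {0..T} \<Longrightarrow> W t \<in> borel_measurable (F t)"
    and ind: "\<And>s t. 0 \<le> s \<Longrightarrow> s < t \<Longrightarrow> t \<le> T \<Longrightarrow> prob_space.indep_set M (sets (F s))
          (sets (vimage_algebra (space M) (\<lambda>\<omega>. W t \<omega> - W s \<omega>) borel))"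
    using W by (auto simp: wiener_process_wrt_def)
  have WM: "W t \<in> borel_measurable M" if "t \<in> {0..T}" for t
    using wp that by (simp add: wiener_process_def)
  interpret prob_space M using wp by (simp add: wiener_process_def)
  have \<tau>: "\<tau> 0 = 0" "\<tau> n = T" "\<And>i. i < n \<Longrightarrow> \<tau> i < \<tau> (Suc i)"
    and \<xi>F: "\<And>i. i < n \<Longrightarrow> \<xi> i \<in> borel_measurable (F (\<tau> i))"
    and \<xi>B: "\<And>i. i < n \<Longrightarrow> \<exists>B. \<forall>\<omega>\<in>space M. \<bar>\<xi> i \<omega>\<bar> \<le> B"
    using \<xi> by (auto simp: simple_integrand_def)
  have \<tau>T: "\<tau> i \<in> {0..T}" if "i \<le> n" for i
    using grid_mono[of n \<tau> 0 i] grid_mono[of n \<tau> i n] \<tau> that by auto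
  have \<xi>int: "integrable M (\<lambda>\<omega>. (\<xi> i \<omega>)\<^sup>2)" if i: "i < n" for i
  proof -
    obtain B where B: "\<forall>\<omega>\<in>space M. \<bar>\<xi> i \<omega>\<bar> \<le> B" using \<xi>B[OF i] by blast
    have "\<xi> i \<in> borel_measurable M" using measurable_from_subalg[OF sub \<xi>F[OF i]] .
    then show ?thesis using B
      by (intro integrable_const_bound[where B = "B\<^sup>2"] AE_I2)
        (auto simp: power2_le_of_abs_le)
  qed
  define I where "I k \<omega> = (\<Sum>i<k. \<xi> i \<omega> * (W (min t (\<tau> (Suc i))) \<omega> - W (min t (\<tau> i)) \<omega>))" for k \<omega>
  have IF: "I k \<in> borel_measurable (F (\<tau> k))" if "k \<le> n" for k
    unfolding I_def
  proof (intro borel_measurable_sum borel_measurable_times borel_measurable_diff)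
    fix i assume "i \<in> {..<k}"
    then have i: "i < n" "i \<le> k" "Suc i \<le> k" using that by auto
    have le: "\<tau> i \<le> \<tau> k" "\<tau> (Suc i) \<le> \<tau> k"
      using grid_mono[of n \<tau>] \<tau>(3) i that by auto
    show "\<xi> i \<in> borel_measurable (F (\<tau> k))"
      using borel_measurable_filtration_mono[OF filt le(1) \<xi>F[OF i(1)]] .
    show "W (min t (\<tau> (Suc i))) \<in> borel_measurable (F (\<tau> k))"
      "W (min t (\<tau> i)) \<in> borel_measurable (F (\<tau> k))"
      using \<tau>T[of i] \<tau>T[of "Suc i"] t i le
      by (auto intro!: borel_measurable_filtration_mono[OF filt _ WF])
  qed
  have "integrable M (\<lambda>\<omega>. (I k \<omega>)\<^sup>2) \<and>
      (LINT \<omega>|M. (I k \<omega>)\<^sup>2) \<le> (LINT \<omega>|M. (\<Sum>i<k. (\<xi> i \<omega>)\<^sup>2 * (\<tau> (Suc i) - \<tau> i)))"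
    if "k \<le> n" for k
    using that
  proof (induction k)
    case 0
    then show ?case by (simp add: I_def)
  next
    case (Suc k)
    then have k: "k < n" "k \<le> n" by auto
    note IH = Suc.IH[OF k(2)]
    have Q: "(LINT \<omega>|M. (\<Sum>i<Suc k. (\<xi> i \<omega>)\<^sup>2 * (\<tau> (Suc i) - \<tau> i)))
        = (LINT \<omega>|M. (\<Sum>i<k. (\<xi> i \<omega>)\<^sup>2 * (\<tau> (Suc i) - \<tau> i)))
          + (LINT \<omega>|M. (\<xi> k \<omega>)\<^sup>2) * (\<tau> (Suc k) - \<tau> k)"
    proof -
      have "integrable M (\<lambda>\<omega>. \<Sum>i<k. (\<xi> i \<omega>)\<^sup>2 * (\<tau> (Suc i) - \<tau> i))"
        using \<xi>int k by (intro Bochner_Integration.integrable_sum integrable_mult_left) auto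
      then show ?thesis using \<xi>int[OF k(1)] by simp
    qed
    have E0: "(LINT \<omega>|M. (\<xi> k \<omega>)\<^sup>2) \<ge> 0" by simp
    show ?case
    proof (cases "t \<le> \<tau> k")
      case True
      then have "I (Suc k) = I k" using \<tau>(3)[OF k(1)] by (simp add: I_def fun_eq_iff min_def)
      moreover have "(LINT \<omega>|M. (\<xi> k \<omega>)\<^sup>2) * (\<tau> (Suc k) - \<tau> k) \<ge> 0"
        using E0 \<tau>(3)[OF k(1)] by simp
      ultimately show ?thesis using IH Q by simp
    next
      case False
      define t' where "t' = min t (\<tau> (Suc k))"
      have t': "0 \<le> \<tau> k" "\<tau> k < t'" "t' \<le> T" "t' \<le> \<tau> (Suc k)" "t' \<in> {0..T}"
        using False \<tau>T[of k] \<tau>T[of "Suc k"] \<tau>(3)[OF k(1)] k t by (auto simp: t'_def)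
      obtain B where B: "\<And>\<omega>. \<omega> \<in> space M \<Longrightarrow> \<bar>\<xi> k \<omega>\<bar> \<le> B" using \<xi>B[OF k(1)] by blast
      have ISuc: "I (Suc k) = (\<lambda>\<omega>. I k \<omega> + \<xi> k \<omega> * (W t' \<omega> - W (\<tau> k) \<omega>))"
        using False by (simp add: I_def fun_eq_iff t'_def)
      have DM: "(\<lambda>\<omega>. W t' \<omega> - W (\<tau> k) \<omega>) \<in> borel_measurable M"
        using WM[OF t'(5)] WM[OF \<tau>T[OF k(2)]] by measurable
      note m = wiener_increment_moments[OF wp t'(1-3)]
      have step: "integrable M (\<lambda>\<omega>. (I (Suc k) \<omega>)\<^sup>2)"
        "(LINT \<omega>|M. (I (Suc k) \<omega>)\<^sup>2) = (LINT \<omega>|M. (I k \<omega>)\<^sup>2) + (LINT \<omega>|M. (\<xi> k \<omega>)\<^sup>2) * (t' - \<tau> k)"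
        unfolding ISuc m(3)[symmetric]
        by (rule martingale_step_second_moment[OF sub ind[OF t'(1-3)] IF[OF k(2)] conjunct1[OF IH]
          \<xi>F[OF k(1)] B DM m(1,2)]; assumption)+
      have "(LINT \<omega>|M. (\<xi> k \<omega>)\<^sup>2) * (t' - \<tau> k) \<le> (LINT \<omega>|M. (\<xi> k \<omega>)\<^sup>2) * (\<tau> (Suc k) - \<tau> k)"
        using E0 t' by (intro mult_left_mono) auto
      then show ?thesis using step IH Q by linarith
    qed
  qed
  from this[of n] show "integrable M (\<lambda>\<omega>. (simple_integral W n \<tau> \<xi> t \<omega>)\<^sup>2)"
    and "(LINT \<omega>|M. (simple_integral W n \<tau> \<xi> t \<omega>)\<^sup>2)
      \<le> (LINT \<omega>|M. (\<Sum>i<n. (\<xi> i \<omega>)\<^sup>2 * (\<tau> (Suc i) - \<tau> i)))"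
    unfolding I_def simple_integral_def by simp_all
qed

text \<open>A form of Lenglart's inequality. Switching the integrand off as soon as its accumulated square
  would exceed \<open>b\<close> keeps it adapted, bounds its second moment by \<open>b\<close>, and changes nothing on the
  event considered; Chebyshev's inequality then applies to the truncated integral.\<close>

lemma simple_integral_tail:
  assumes W: "wiener_process_wrt M F T W" and t: "t \<in> {0..T}"
    and \<xi>: "simple_integrand M F T n \<tau> \<xi>" and a: "a > 0" and b: "b \<ge> 0"
  shows "measure M {\<omega>\<in>space M. (\<Sum>i<n. (\<xi> i \<omega>)\<^sup>2 * (\<tau> (Suc i) - \<tau> i)) \<le> b \<and>
      \<bar>simple_integral W n \<tau> \<xi> t \<omega>\<bar> > a} \<le> b / a\<^sup>2"
proof -
  have wp: "wiener_process M T W" and filt: "filtration (space M) F"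
    and sub: "\<And>t. subalgebra M (F t)"
    using W by (auto simp: wiener_process_wrt_def)
  interpret prob_space M using wp by (simp add: wiener_process_def)
  have \<tau>: "\<tau> 0 = 0" "\<tau> n = T" "\<And>i. i < n \<Longrightarrow> \<tau> i < \<tau> (Suc i)"
    and \<xi>F: "\<And>i. i < n \<Longrightarrow> \<xi> i \<in> borel_measurable (F (\<tau> i))"
    and \<xi>B: "\<And>i. i < n \<Longrightarrow> \<exists>B. \<forall>\<omega>\<in>space M. \<bar>\<xi> i \<omega>\<bar> \<le> B"
    using \<xi> by (auto simp: simple_integrand_def)
  define V where "V k \<omega> = (\<Sum>i<k. (\<xi> i \<omega>)\<^sup>2 * (\<tau> (Suc i) - \<tau> i))" for k \<omega>
  \<comment> \<open>The sum up to and including the \<open>i\<close>-th interval is known at time \<open>\<tau> i\<close>, so \<open>\<zeta> i\<close> is adapted.\<close>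
  define \<zeta> where "\<zeta> i \<omega> = (if V (Suc i) \<omega> \<le> b then \<xi> i \<omega> else 0)" for i \<omega>
  have V_mono: "V i \<omega> \<le> V j \<omega>" if "i \<le> j" "j \<le> n" for i j \<omega>
    unfolding V_def using that \<tau>(3)
    by (intro sum_mono2) (auto intro!: mult_nonneg_nonneg simp: less_imp_le)
  have \<zeta>: "simple_integrand M F T n \<tau> \<zeta>"
    unfolding simple_integrand_def
  proof (intro conjI allI impI)
    fix i assume i: "i < n"
    have m: "\<xi> j \<in> borel_measurable (F (\<tau> i))" if "j \<le> i" for j
      using that i \<tau>(3) by (intro borel_measurable_filtration_mono[OF filt _ \<xi>F] grid_mono[of n]) auto
    have [measurable]: "V (Suc i) \<in> borel_measurable (F (\<tau> i))"
      unfolding V_def using m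
      by (intro borel_measurable_sum borel_measurable_times borel_measurable_power borel_measurable_const) auto
    have [measurable]: "\<xi> i \<in> borel_measurable (F (\<tau> i))" using m by simp
    show "\<zeta> i \<in> borel_measurable (F (\<tau> i))"
      unfolding \<zeta>_def by measurable
    show "\<exists>B. \<forall>\<omega>\<in>space M. \<bar>\<zeta> i \<omega>\<bar> \<le> B"
    proof -
      obtain B where "\<forall>\<omega>\<in>space M. \<bar>\<xi> i \<omega>\<bar> \<le> B" using \<xi>B[OF i] by blast
      then have "\<forall>\<omega>\<in>space M. \<bar>\<zeta> i \<omega>\<bar> \<le> B" by (fastforce simp: \<zeta>_def)
      then show ?thesis by blast
    qed
  qed (use \<tau> in auto)
  have \<zeta>_le: "(\<Sum>i<n. (\<zeta> i \<omega>)\<^sup>2 * (\<tau> (Suc i) - \<tau> i)) \<le> b" for \<omega>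
  proof -
    have "(\<Sum>i<k. (\<zeta> i \<omega>)\<^sup>2 * (\<tau> (Suc i) - \<tau> i)) \<le> min b (V k \<omega>)" if "k \<le> n" for k
      using that
    proof (induction k)
      case 0
      then show ?case using b by (simp add: V_def)
    next
      case (Suc k)
      then have "V (Suc k) \<omega> = V k \<omega> + (\<xi> k \<omega>)\<^sup>2 * (\<tau> (Suc k) - \<tau> k)" by (simp add: V_def)
      with Suc V_mono[of k "Suc k" \<omega>] show ?case by (auto simp: \<zeta>_def)
    qed
    from this[of n] show ?thesis by simp
  qed
  have eq: "simple_integral W n \<tau> \<zeta> t \<omega> = simple_integral W n \<tau> \<xi> t \<omega>" if "V n \<omega> \<le> b" for \<omega>
  proof -
    have "\<zeta> i \<omega> = \<xi> i \<omega>" if "i < n" for i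
      using V_mono[of "Suc i" n \<omega>] \<open>V n \<omega> \<le> b\<close> that by (auto simp: \<zeta>_def)
    then show ?thesis by (simp add: simple_integral_def)
  qed
  note sq = simple_integral_second_moment[OF W t \<zeta>]
  have square_le: "a\<^sup>2 \<le> y\<^sup>2" if "a < \<bar>y\<bar>" for y
    using that a power_mono[of a "\<bar>y\<bar>" 2] by simp
  have "{\<omega>\<in>space M. V n \<omega> \<le> b \<and> \<bar>simple_integral W n \<tau> \<xi> t \<omega>\<bar> > a}
      \<subseteq> {\<omega>\<in>space M. (simple_integral W n \<tau> \<zeta> t \<omega>)\<^sup>2 \<ge> a\<^sup>2}"
    using eq a by (auto simp: square_le)
  moreover have meas: "{\<omega>\<in>space M. (simple_integral W n \<tau> \<zeta> t \<omega>)\<^sup>2 \<ge> a\<^sup>2} \<in> sets M"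
    using sq(1) by measurable
  ultimately have "measure M {\<omega>\<in>space M. V n \<omega> \<le> b \<and> \<bar>simple_integral W n \<tau> \<xi> t \<omega>\<bar> > a}
      \<le> measure M {\<omega>\<in>space M. (simple_integral W n \<tau> \<zeta> t \<omega>)\<^sup>2 \<ge> a\<^sup>2}"
    by (rule finite_measure_mono)
  also have "\<dots> \<le> (LINT \<omega>|M. (simple_integral W n \<tau> \<zeta> t \<omega>)\<^sup>2) / a\<^sup>2"
    using sq(1) a by (intro integral_Markov_inequality_measure[OF _ sets.empty_sets]) auto
  also have "\<dots> \<le> b / a\<^sup>2"
  proof (rule divide_right_mono)
    have "(LINT \<omega>|M. (\<Sum>i<n. (\<zeta> i \<omega>)\<^sup>2 * (\<tau> (Suc i) - \<tau> i))) \<le> (LINT \<omega>|M. b)"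
    proof (cases "integrable M (\<lambda>\<omega>. \<Sum>i<n. (\<zeta> i \<omega>)\<^sup>2 * (\<tau> (Suc i) - \<tau> i))")
      case True
      then show ?thesis using \<zeta>_le by (intro integral_mono) auto
    qed (simp add: not_integrable_integral_eq b)
    also have "\<dots> = b" by (simp add: prob_space)
    finally show "(LINT \<omega>|M. (simple_integral W n \<tau> \<zeta> t \<omega>)\<^sup>2) \<le> b" using sq(2) by linarith
  qed simp
  finally show ?thesis unfolding V_def .
qed

lemma simple_process_square_integral_ge:
  assumes "simple_integrand M F T n \<tau> \<xi>"
  shows "ennreal (\<Sum>i<n. (\<xi> i \<omega>)\<^sup>2 * (\<tau> (Suc i) - \<tau> i))
    \<le> (\<integral>\<^sup>+s\<in>{0..T}. ennreal ((simple_process n \<tau> \<xi> s \<omega>)\<^sup>2) \<partial>lborel)"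
proof -
  have \<tau>: "\<tau> 0 = 0" "\<tau> n = T" "\<And>i. i < n \<Longrightarrow> \<tau> i < \<tau> (Suc i)"
    using assms by (auto simp: simple_integrand_def)
  note mono = grid_mono[of n \<tau>, OF \<tau>(3)]
  have "ennreal (\<Sum>i<n. (\<xi> i \<omega>)\<^sup>2 * (\<tau> (Suc i) - \<tau> i))
      = (\<Sum>i<n. ennreal ((\<xi> i \<omega>)\<^sup>2) * emeasure lborel {\<tau> i<..\<tau> (Suc i)})"
    using \<tau>(3) by (subst sum_ennreal[symmetric]) (auto intro!: sum.cong simp: ennreal_mult less_imp_le)
  also have "\<dots> = (\<Sum>i<n. \<integral>\<^sup>+s. ennreal ((\<xi> i \<omega>)\<^sup>2) * indicator {\<tau> i<..\<tau> (Suc i)} s \<partial>lborel)"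
    by (simp add: nn_integral_cmult_indicator)
  also have "\<dots> = (\<integral>\<^sup>+s. (\<Sum>i<n. ennreal ((\<xi> i \<omega>)\<^sup>2) * indicator {\<tau> i<..\<tau> (Suc i)} s) \<partial>lborel)"
    by (subst nn_integral_sum) auto
  also have "\<dots> \<le> (\<integral>\<^sup>+s\<in>{0..T}. ennreal ((simple_process n \<tau> \<xi> s \<omega>)\<^sup>2) \<partial>lborel)"
  proof (rule nn_integral_mono)
    fix s
    show "(\<Sum>i<n. ennreal ((\<xi> i \<omega>)\<^sup>2) * indicator {\<tau> i<..\<tau> (Suc i)} s)
        \<le> ennreal ((simple_process n \<tau> \<xi> s \<omega>)\<^sup>2) * indicator {0..T} s"
    proof (cases "\<exists>j<n. s \<in> {\<tau> j<..\<tau> (Suc j)}")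
      case True
      then obtain j where j: "j < n" "s \<in> {\<tau> j<..\<tau> (Suc j)}" by blast
      have other: "s \<notin> {\<tau> i<..\<tau> (Suc i)}" if "i < n" "i \<noteq> j" for i
        using mono[of "Suc i" j] mono[of "Suc j" i] that j by (cases "i < j") auto
      have "(\<Sum>i<n. ennreal ((\<xi> i \<omega>)\<^sup>2) * indicator {\<tau> i<..\<tau> (Suc i)} s)
          = (\<Sum>i<n. if i = j then ennreal ((\<xi> j \<omega>)\<^sup>2) else 0)"
        using other j by (intro sum.cong) (auto simp: indicator_def)
      moreover have "simple_process n \<tau> \<xi> s \<omega> = (\<Sum>i<n. if i = j then \<xi> j \<omega> else 0)"
        unfolding simple_process_def using other j by (intro sum.cong) (auto simp: indicator_def)
      moreover have "s \<in> {0..T}" using mono[of 0 j] mono[of "Suc j" n] j \<tau> by auto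
      ultimately show ?thesis using j by simp
    next
      case False
      then have "(\<Sum>i<n. ennreal ((\<xi> i \<omega>)\<^sup>2) * indicator {\<tau> i<..\<tau> (Suc i)} s) = 0"
        by (intro sum.neutral) (auto simp: indicator_def)
      then show ?thesis by simp
    qed
  qed
  finally show ?thesis .
qed

lemma simple_process_jointly_measurable:
  assumes "simple_integrand M F T n \<tau> \<xi>" "\<And>t. subalgebra M (F t)"
  shows "(\<lambda>(s, \<omega>). simple_process n \<tau> \<xi> s \<omega>) \<in> borel_measurable (restrict_space borel {0..T} \<Otimes>\<^sub>M M)"
proof -
  have [measurable]: "(\<lambda>p. fst p) \<in> borel_measurable (restrict_space borel {0..T} \<Otimes>\<^sub>M M)"
    by (rule measurable_compose[OF measurable_fst]) (simp add: measurable_restrict_space1)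
  have "(\<lambda>p. \<xi> i (snd p) * indicator {\<tau> i<..\<tau> (Suc i)} (fst p))
      \<in> borel_measurable (restrict_space borel {0..T} \<Otimes>\<^sub>M M)" if "i < n" for i
  proof -
    have [measurable]: "\<xi> i \<in> borel_measurable M"
      using assms that measurable_from_subalg unfolding simple_integrand_def by blast
    show ?thesis by measurable
  qed
  then show ?thesis
    unfolding simple_process_def case_prod_beta by (intro borel_measurable_sum) auto
qed

text \<open>Transfer of the bound for simple integrands through convergence in probability. The factors
  \<open>2\<close> and \<open>4\<close> are what this costs: one \<open>a\<close> for the distance between the integrals, and
  \<open>u\<^sup>2 \<le> 2 (u - v)\<^sup>2 + 2 v\<^sup>2\<close> for the integrands. The bound on the quadratic variation
  is asked for on \<open>\<Omega>\<close> alone, so that it may come from what that event says about the solution.\<close>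

lemma ito_integral_tail:
  assumes W: "wiener_process_wrt M F T W" and I: "is_ito_integral M F T W H I"
    and t: "t \<in> {0..T}" and a: "a > 0" and b: "b > 0" and \<Omega>: "\<Omega> \<subseteq> space M"
    and small: "\<And>\<omega>. \<omega> \<in> \<Omega> \<Longrightarrow> (\<integral>\<^sup>+s\<in>{0..T}. ennreal ((H s \<omega>)\<^sup>2) \<partial>lborel) \<le> ennreal b"
  shows "measure M {\<omega>\<in>\<Omega>. \<bar>I t \<omega>\<bar> > 2 * a} \<le> 4 * b / a\<^sup>2" (is "measure M ?E \<le> _")
proof -
  have wp: "wiener_process M T W" and sub: "\<And>t. subalgebra M (F t)"
    using W by (auto simp: wiener_process_wrt_def)
  interpret prob_space M using wp by (simp add: wiener_process_def)
  define R where "R = restrict_space borel {0..T} \<Otimes>\<^sub>M M"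
  obtain n \<tau> \<xi> where \<xi>: "\<And>k::nat. simple_integrand M F T (n k) (\<tau> k) (\<xi> k)"
    and limA: "\<And>e. e > 0 \<Longrightarrow> (\<lambda>k. prob {\<omega>\<in>space M.
      (\<integral>\<^sup>+s\<in>{0..T}. ennreal ((simple_process (n k) (\<tau> k) (\<xi> k) s \<omega> - H s \<omega>)\<^sup>2) \<partial>lborel)
              > ennreal e}) \<longlonglongrightarrow> 0"
    and limB: "\<And>e. e > 0 \<Longrightarrow> (\<lambda>k. prob {\<omega>\<in>space M.
            \<bar>simple_integral W (n k) (\<tau> k) (\<xi> k) t \<omega> - I t \<omega>\<bar> > e}) \<longlonglongrightarrow> 0"
    using I t unfolding is_ito_integral_def by blast
  have T0: "0 \<le> T" using t by simp
  have IM[measurable]: "I t \<in> borel_measurable M" using I t by (simp add: is_ito_integral_def)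
  have HR: "(\<lambda>(s, \<omega>). H s \<omega>) \<in> borel_measurable R"
  proof -
    have "(\<lambda>(s, \<omega>). H s \<omega>) \<in> borel_measurable (restrict_space borel {0..T} \<Otimes>\<^sub>M F T)"
      using I T0 by (simp add: is_ito_integral_def)
    moreover have "(\<lambda>p. p) \<in> measurable R (restrict_space borel {0..T} \<Otimes>\<^sub>M F T)"
    proof -
      have "(\<lambda>x. x) \<in> measurable M (F T)"
        using sub[of T] by (auto simp: subalgebra_def measurable_def sets.Int_space_eq2)
      then have "(\<lambda>p. (fst p, snd p)) \<in> measurable R (restrict_space borel {0..T} \<Otimes>\<^sub>M F T)"
        unfolding R_def by (intro measurable_Pair measurable_fst measurable_compose[OF measurable_snd])
      then show ?thesis by simp
    qed
    ultimately show ?thesis using measurable_compose by fastforce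
  qed
  define D where "D k \<omega> = (\<integral>\<^sup>+s\<in>{0..T}. ennreal ((simple_process (n k) (\<tau> k) (\<xi> k) s \<omega> - H s \<omega>)\<^sup>2) \<partial>lborel)" for k \<omega>
  define V where "V k \<omega> = (\<Sum>i<n k. (\<xi> k i \<omega>)\<^sup>2 * (\<tau> k (Suc i) - \<tau> k i))" for k \<omega>
  define J where "J k \<omega> = simple_integral W (n k) (\<tau> k) (\<xi> k) t \<omega>" for k \<omega>
  have SR: "(\<lambda>(s, \<omega>). simple_process (n k) (\<tau> k) (\<xi> k) s \<omega>) \<in> borel_measurable R" for k
    unfolding R_def using simple_process_jointly_measurable[OF \<xi> sub] .
  have [measurable]: "D k \<in> borel_measurable M" for k
    unfolding D_def
  proof (rule borel_measurable_nn_integral_time)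
    show "(\<lambda>(s, \<omega>). ennreal ((simple_process (n k) (\<tau> k) (\<xi> k) s \<omega> - H s \<omega>)\<^sup>2))
        \<in> borel_measurable (restrict_space borel {0..T} \<Otimes>\<^sub>M M)"
      using SR HR unfolding R_def case_prod_beta by measurable
  qed
  have \<xi>M: "\<xi> k i \<in> borel_measurable M" if "i < n k" for k i
    using \<xi>[of k] measurable_from_subalg[OF sub] that unfolding simple_integrand_def by blast
  have \<tau>T: "\<tau> k i \<in> {0..T}" if "i \<le> n k" for k i
    using \<xi>[of k] that grid_mono[of "n k" "\<tau> k" 0 i] grid_mono[of "n k" "\<tau> k" i "n k"]
    by (auto simp: simple_integrand_def)
  have WM: "W s \<in> borel_measurable M" if "s \<in> {0..T}" for s
    using wp that by (simp add: wiener_process_def)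
  have [measurable]: "V k \<in> borel_measurable M" for k
    unfolding V_def using \<xi>M by (intro borel_measurable_sum borel_measurable_times
        borel_measurable_power borel_measurable_const) auto
  have [measurable]: "J k \<in> borel_measurable M" for k
    unfolding J_def simple_integral_def
  proof (intro borel_measurable_sum borel_measurable_times borel_measurable_diff)
    fix i assume "i \<in> {..<n k}"
    then show "\<xi> k i \<in> borel_measurable M"
      "W (min t (\<tau> k (Suc i))) \<in> borel_measurable M" "W (min t (\<tau> k i)) \<in> borel_measurable M"
      using \<xi>M \<tau>T[of "Suc i" k] \<tau>T[of i k] t by (auto intro!: WM)
  qed
  define A where "A k = {\<omega>\<in>space M. D k \<omega> > ennreal b}" for k
  define B where "B k = {\<omega>\<in>space M. \<bar>J k \<omega> - I t \<omega>\<bar> > a}" for k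
  define C where "C k = {\<omega>\<in>space M. V k \<omega> \<le> 4 * b \<and> \<bar>J k \<omega>\<bar> > a}" for k
  have [measurable]: "A k \<in> sets M" "B k \<in> sets M" "C k \<in> sets M" for k
    unfolding A_def B_def C_def by measurable
  \<comment> \<open>Either an approximation is bad, or the simple integral itself is large with small accumulated square.\<close>
  have cover: "?E \<subseteq> A k \<union> B k \<union> C k" for k
  proof
    fix \<omega> assume \<omega>: "\<omega> \<in> ?E"
    then have "\<omega> \<in> space M" using \<Omega> by auto
    show "\<omega> \<in> A k \<union> B k \<union> C k"
    proof (rule ccontr)
      assume no: "\<omega> \<notin> A k \<union> B k \<union> C k"
      then have D: "D k \<omega> \<le> ennreal b" and B: "\<bar>J k \<omega> - I t \<omega>\<bar> \<le> a"
        using \<open>\<omega> \<in> space M\<close> by (auto simp: A_def B_def not_less)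
      let ?Q = "restrict_space lborel {0..T}" and ?S = "\<lambda>s. simple_process (n k) (\<tau> k) (\<xi> k) s \<omega>"
      have sec: "(\<lambda>s. f s \<omega>) \<in> borel_measurable ?Q" if "(\<lambda>(s, \<omega>). f s \<omega>) \<in> borel_measurable R" for f :: "real \<Rightarrow> 'a \<Rightarrow> real"
      proof -
        have "(\<lambda>(\<omega>, s). f s \<omega>) \<in> borel_measurable (M \<Otimes>\<^sub>M ?Q)"
          using measurable_pair_swap_Icc that unfolding R_def .
        from measurable_Pair2[OF this \<open>\<omega> \<in> space M\<close>] show ?thesis by simp
      qed
      have [measurable]: "?S \<in> borel_measurable ?Q" "(\<lambda>s. H s \<omega>) \<in> borel_measurable ?Q"
        using sec[OF SR] sec[OF HR] by auto
      have "ennreal (V k \<omega>) \<le> (\<integral>\<^sup>+s. ennreal ((?S s)\<^sup>2) \<partial>?Q)"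
        using simple_process_square_integral_ge[OF \<xi>] by (simp add: V_def nn_integral_restrict_space)
      also have "\<dots> \<le> (\<integral>\<^sup>+s. 2 * ennreal ((?S s - H s \<omega>)\<^sup>2) + 2 * ennreal ((H s \<omega>)\<^sup>2) \<partial>?Q)"
      proof (rule nn_integral_mono)
        fix s
        have "(?S s)\<^sup>2 \<le> 2 * (?S s - H s \<omega>)\<^sup>2 + 2 * (H s \<omega>)\<^sup>2"
          using zero_le_power2[of "?S s - 2 * H s \<omega>"] by (simp add: power2_eq_square algebra_simps)
        then have "ennreal ((?S s)\<^sup>2) \<le> ennreal (2 * (?S s - H s \<omega>)\<^sup>2 + 2 * (H s \<omega>)\<^sup>2)"
          by (rule ennreal_leI)
        then show "ennreal ((?S s)\<^sup>2) \<le> 2 * ennreal ((?S s - H s \<omega>)\<^sup>2) + 2 * ennreal ((H s \<omega>)\<^sup>2)"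
          by (simp add: ennreal_mult' ennreal_plus)
      qed
      also have "\<dots> = 2 * D k \<omega> + 2 * (\<integral>\<^sup>+s\<in>{0..T}. ennreal ((H s \<omega>)\<^sup>2) \<partial>lborel)"
        by (subst nn_integral_add) (auto simp: nn_integral_cmult D_def nn_integral_restrict_space)
      also have "\<dots> \<le> 2 * ennreal b + 2 * ennreal b"
        using D \<omega> small by (intro add_mono mult_left_mono) auto
      also have "\<dots> = ennreal (4 * b)"
        using b by (simp add: ennreal_mult' flip: distrib_right)
      finally have "V k \<omega> \<le> 4 * b" using b by (simp add: ennreal_le_iff)
      with no have "\<bar>J k \<omega>\<bar> \<le> a" using \<open>\<omega> \<in> space M\<close> by (auto simp: C_def not_less)
      with B \<omega> show False by auto
    qed
  qed
  have bound: "prob ?E \<le> prob (A k) + prob (B k) + 4 * b / a\<^sup>2" for k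
  proof -
    have "prob ?E \<le> prob (A k \<union> B k \<union> C k)" using cover by (intro finite_measure_mono) auto
    also have "\<dots> \<le> prob (A k) + prob (B k) + prob (C k)"
      using measure_Un_le[of "A k \<union> B k" M "C k"] measure_Un_le[of "A k" M "B k"] by auto
    also have "prob (C k) \<le> 4 * b / a\<^sup>2"
      unfolding C_def V_def J_def using b by (intro simple_integral_tail[OF W t \<xi> a]) auto
    finally show ?thesis by simp
  qed
  have "(\<lambda>k. prob (A k) + prob (B k) + 4 * b / a\<^sup>2) \<longlonglongrightarrow> 0 + 0 + 4 * b / a\<^sup>2"
    unfolding A_def B_def D_def J_def using limA[OF b] limB[OF a] by (intro tendsto_intros)
  then show ?thesis using bound by (intro tendsto_lowerbound[of _ "4 * b / a\<^sup>2"]) auto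
qed

section \<open>Solutions of the perturbed equation leave the unperturbed path\<close>

text \<open>Subtracting the two integral equations gives
  \<open>\<integral>\<^sub>0\<^sup>t (S(x) - S\<^sub>0(x)) = (X\<^sub>t - x\<^sub>t) - I\<^sub>t - \<integral>\<^sub>0\<^sup>t (S(X) - S(x))\<close>. When \<open>X - x\<close> is of order \<open>\<epsilon>\<close> in mean
  square so is the last integral, because \<open>S\<close> is Lipschitz; only \<open>I\<close> can account for the rest.\<close>

lemma pathwise_lower_bound:
  fixes X I xs S S0 :: "real \<Rightarrow> real"
  assumes T: "T > 0" and \<epsilon>: "\<epsilon> > 0" and K: "K \<ge> 0" and L: "L > 0"
    and cX: "continuous_on {0..T} X" and cI: "continuous_on {0..T} I" and cxs: "continuous_on {0..T} xs"
    and lipS: "\<And>x y. \<bar>S x - S y\<bar> \<le> L * \<bar>x - y\<bar>" and cS0: "continuous_on UNIV S0"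
    and X: "\<And>t. t \<in> {0..T} \<Longrightarrow> X t = x0 + integral {0..t} (\<lambda>s. S (X s)) + I t"
    and xs: "\<And>t. t \<in> {0..T} \<Longrightarrow> xs t = x0 + integral {0..t} (\<lambda>s. S0 (xs s))"
    and near: "integral {0..T} (\<lambda>t. (X t - xs t)\<^sup>2) \<le> K * \<epsilon>\<^sup>2"
  shows "integral {0..T} (\<lambda>t. min ((integral {0..t} (\<lambda>s. S (xs s) - S0 (xs s)))\<^sup>2) 1)
    \<le> 3 * integral {0..T} (\<lambda>t. min ((I t)\<^sup>2) 1) + (3 * K + 3 * T * (L * (T + K) / 2)\<^sup>2) * \<epsilon>\<^sup>2"
proof -
  define G where "G t = integral {0..t} (\<lambda>s. S (xs s) - S0 (xs s))" for t
  define C where "C = L * (T + K) / 2"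
  have "L-lipschitz_on UNIV S" using lipS L by (intro lipschitz_onI) (auto simp: dist_real_def)
  then have cS: "continuous_on UNIV S" by (rule lipschitz_on_continuous_on)
  have cSX: "continuous_on {0..T} (\<lambda>s. S (X s))" and cSxs: "continuous_on {0..T} (\<lambda>s. S (xs s))"
    and cS0xs: "continuous_on {0..T} (\<lambda>s. S0 (xs s))"
    using continuous_on_compose2[OF cS cX] continuous_on_compose2[OF cS cxs]
      continuous_on_compose2[OF cS0 cxs] by auto
  have sub: "f integrable_on {0..t}" if "continuous_on {0..T} f" "t \<in> {0..T}" for f :: "real \<Rightarrow> real" and t
    using that by (intro integrable_continuous_interval continuous_on_subset[OF that(1)]) auto
  have drift: "\<bar>integral {0..t} (\<lambda>s. S (X s) - S (xs s))\<bar> \<le> C * \<epsilon>" if t: "t \<in> {0..T}" for t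
  proof -
    \<comment> \<open>Cauchy--Schwarz through Young's inequality with weight \<open>\<epsilon>\<close>, the size of the deviation.\<close>
    have "\<bar>integral {0..t} (\<lambda>s. S (X s) - S (xs s))\<bar> \<le> integral {0..t} (\<lambda>s. \<bar>S (X s) - S (xs s)\<bar>)"
      unfolding real_norm_def[symmetric]
      by (intro Henstock_Kurzweil_Integration.integral_norm_bound_integral sub[OF _ t]
          continuous_intros cSX cSxs) auto
    also have "\<dots> \<le> integral {0..T} (\<lambda>s. \<bar>S (X s) - S (xs s)\<bar>)"
      using t by (intro integral_subset_le sub continuous_intros cSX cSxs) auto
    also have "\<dots> \<le> integral {0..T} (\<lambda>s. L / 2 * \<epsilon> + L / (2 * \<epsilon>) * (X s - xs s)\<^sup>2)"
    proof (rule integral_le)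
      fix s
      have "0 \<le> (\<epsilon> - \<bar>X s - xs s\<bar>)\<^sup>2" by simp
      then have "2 * \<epsilon> * \<bar>X s - xs s\<bar> \<le> \<epsilon>\<^sup>2 + (X s - xs s)\<^sup>2"
        by (simp add: power2_diff)
      then have "L / (2 * \<epsilon>) * (2 * \<epsilon> * \<bar>X s - xs s\<bar>) \<le> L / (2 * \<epsilon>) * (\<epsilon>\<^sup>2 + (X s - xs s)\<^sup>2)"
        using L \<epsilon> by (intro mult_left_mono) auto
      also have "L / (2 * \<epsilon>) * (\<epsilon>\<^sup>2 + (X s - xs s)\<^sup>2) = L / 2 * \<epsilon> + L / (2 * \<epsilon>) * (X s - xs s)\<^sup>2"
        using \<epsilon> by (simp add: distrib_left power2_eq_square)
      finally have "L * \<bar>X s - xs s\<bar> \<le> L / 2 * \<epsilon> + L / (2 * \<epsilon>) * (X s - xs s)\<^sup>2"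
        using \<epsilon> by simp
      then show "\<bar>S (X s) - S (xs s)\<bar> \<le> L / 2 * \<epsilon> + L / (2 * \<epsilon>) * (X s - xs s)\<^sup>2"
        using lipS[of "X s" "xs s"] by linarith
    qed (use T \<epsilon> in \<open>auto intro!: sub continuous_intros cSX cSxs cX cxs\<close>)
    also have "\<dots> = T * (L / 2 * \<epsilon>) + L / (2 * \<epsilon>) * integral {0..T} (\<lambda>s. (X s - xs s)\<^sup>2)"
      using T \<epsilon> by (subst Henstock_Kurzweil_Integration.integral_add)
        (auto intro!: integrable_continuous_interval continuous_intros cX cxs)
    also have "\<dots> \<le> T * (L / 2 * \<epsilon>) + L / (2 * \<epsilon>) * (K * \<epsilon>\<^sup>2)"
      using near L \<epsilon> by (intro add_left_mono mult_left_mono) auto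
    also have "\<dots> = C * \<epsilon>" using \<epsilon> by (simp add: C_def power2_eq_square field_simps)
    finally show ?thesis .
  qed
  have cG: "continuous_on {0..T} G"
    unfolding G_def by (intro indefinite_integral_continuous_1 integrable_continuous_interval continuous_intros cSxs cS0xs)
  have point: "min ((G t)\<^sup>2) 1 \<le> 3 * (X t - xs t)\<^sup>2 + 3 * min ((I t)\<^sup>2) 1 + 3 * (C * \<epsilon>)\<^sup>2"
    if t: "t \<in> {0..T}" for t
  proof -
    define d where "d = integral {0..t} (\<lambda>s. S (X s) - S (xs s))"
    have "X t - xs t = integral {0..t} (\<lambda>s. S (X s)) - integral {0..t} (\<lambda>s. S0 (xs s)) + I t"
      using X[OF t] xs[OF t] by simp
    moreover have "G t = integral {0..t} (\<lambda>s. S (xs s)) - integral {0..t} (\<lambda>s. S0 (xs s))"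
      unfolding G_def by (intro Henstock_Kurzweil_Integration.integral_diff sub[OF _ t] cSxs cS0xs)
    moreover have "d = integral {0..t} (\<lambda>s. S (X s)) - integral {0..t} (\<lambda>s. S (xs s))"
      unfolding d_def by (intro Henstock_Kurzweil_Integration.integral_diff sub[OF _ t] cSX cSxs)
    ultimately have G: "G t = (X t - xs t) - I t - d" by simp
    have "(G t)\<^sup>2 \<le> 3 * (X t - xs t)\<^sup>2 + 3 * (I t)\<^sup>2 + 3 * d\<^sup>2"
      using zero_le_power2[of "(X t - xs t) + I t"] zero_le_power2[of "(X t - xs t) + d"]
        zero_le_power2[of "I t - d"]
      unfolding G by (simp add: power2_eq_square algebra_simps)
    moreover have "d\<^sup>2 \<le> (C * \<epsilon>)\<^sup>2"
      using power2_le_of_abs_le[OF drift[OF t]] by (simp add: d_def)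
    moreover have "min g 1 \<le> 3 * p + 3 * min i 1 + 3 * c"
      if "g \<le> 3 * p + 3 * i + 3 * e" "e \<le> c" "0 \<le> p" "0 \<le> c" for g p i e c :: real
      using that by (auto simp: min_def)
    ultimately show ?thesis using zero_le_power2 by blast
  qed
  have "integral {0..T} (\<lambda>t. min ((G t)\<^sup>2) 1)
      \<le> integral {0..T} (\<lambda>t. 3 * (X t - xs t)\<^sup>2 + 3 * min ((I t)\<^sup>2) 1 + 3 * (C * \<epsilon>)\<^sup>2)"
    using point by (intro integral_le integrable_continuous_interval continuous_intros cG cX cxs cI) auto
  also have "\<dots> = 3 * integral {0..T} (\<lambda>t. (X t - xs t)\<^sup>2)
      + 3 * integral {0..T} (\<lambda>t. min ((I t)\<^sup>2) 1) + T * (3 * (C * \<epsilon>)\<^sup>2)"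
    using T by (subst Henstock_Kurzweil_Integration.integral_add
        | force intro!: integrable_continuous_interval continuous_intros cX cxs cI)+
  also have "\<dots> \<le> 3 * (K * \<epsilon>\<^sup>2) + 3 * integral {0..T} (\<lambda>t. min ((I t)\<^sup>2) 1) + T * (3 * (C * \<epsilon>)\<^sup>2)"
    using near by simp
  also have "\<dots> = 3 * integral {0..T} (\<lambda>t. min ((I t)\<^sup>2) 1) + (3 * K + 3 * T * C\<^sup>2) * \<epsilon>\<^sup>2"
    by (simp add: power_mult_distrib algebra_simps)
  finally show ?thesis unfolding G_def C_def .
qed

text \<open>Fubini exchanges the time integral with the expectation, and at each fixed time the truncated
  square is at most \<open>4 a\<^sup>2\<close> off an event to which the tail bound applies. The truncation at \<open>1\<close> keeps
  that event's contribution below its probability.\<close>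

lemma ito_integral_truncated_square:
  assumes W: "wiener_process_wrt M F T W" and I: "is_ito_integral M F T W H I" and T: "T > 0"
    and a: "a > 0" and b: "b > 0" and A: "A \<in> sets M"
    and Ab: "\<And>\<omega>. \<omega> \<in> A \<Longrightarrow> (\<integral>\<^sup>+s\<in>{0..T}. ennreal ((H s \<omega>)\<^sup>2) \<partial>lborel) \<le> ennreal b"
  shows "(\<integral>\<^sup>+\<omega>\<in>A. (\<integral>\<^sup>+t\<in>{0..T}. ennreal (min ((I t \<omega>)\<^sup>2) 1) \<partial>lborel) \<partial>M)
    \<le> ennreal (T * (4 * a\<^sup>2 + 4 * b / a\<^sup>2))"
proof -
  have wp: "wiener_process M T W" using W by (auto simp: wiener_process_wrt_def)
  interpret prob_space M using wp by (simp add: wiener_process_def)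
  let ?Q = "restrict_space lborel {0..T}"
  interpret Q: sigma_finite_measure ?Q by (rule sigma_finite_lborel_Icc)
  interpret MQ: pair_sigma_finite M ?Q ..
  have [measurable]: "A \<in> sets M" by (rule A)
  have IM: "\<And>t. t \<in> {0..T} \<Longrightarrow> I t \<in> borel_measurable M"
    and Icont: "\<And>\<omega>. \<omega> \<in> space M \<Longrightarrow> continuous_on {0..T} (\<lambda>t. I t \<omega>)"
    using I by (auto simp: is_ito_integral_def)
  have [measurable]: "(\<lambda>(\<omega>, t). I t \<omega>) \<in> borel_measurable (M \<Otimes>\<^sub>M ?Q)"
    by (rule measurable_pair_swap_Icc[OF continuous_process_jointly_measurable[OF T IM Icont]])
  have pt: "(\<integral>\<^sup>+\<omega>\<in>A. ennreal (min ((I t \<omega>)\<^sup>2) 1) \<partial>M) \<le> ennreal (4 * a\<^sup>2 + 4 * b / a\<^sup>2)"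
    if t: "t \<in> {0..T}" for t
  proof -
    have [measurable]: "I t \<in> borel_measurable M" using IM t .
    have "(\<integral>\<^sup>+\<omega>\<in>A. ennreal (min ((I t \<omega>)\<^sup>2) 1) \<partial>M)
        \<le> (\<integral>\<^sup>+\<omega>. ennreal (4 * a\<^sup>2) + indicator {\<omega>\<in>A. \<bar>I t \<omega>\<bar> > 2 * a} \<omega> \<partial>M)"
    proof (rule nn_integral_mono)
      fix \<omega>
      have "min ((I t \<omega>)\<^sup>2) 1 \<le> 4 * a\<^sup>2" if "\<not> \<bar>I t \<omega>\<bar> > 2 * a"
        using power2_le_of_abs_le[of "I t \<omega>" "2 * a"] that by (auto simp: power_mult_distrib)
      then show "ennreal (min ((I t \<omega>)\<^sup>2) 1) * indicator A \<omega>
          \<le> ennreal (4 * a\<^sup>2) + indicator {\<omega>\<in>A. \<bar>I t \<omega>\<bar> > 2 * a} \<omega>"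
        by (cases "\<bar>I t \<omega>\<bar> > 2 * a")
          (auto simp: indicator_def ennreal_le_1 intro: ennreal_leI add_increasing)
    qed
    also have "\<dots> = ennreal (4 * a\<^sup>2) + emeasure M {\<omega>\<in>A. \<bar>I t \<omega>\<bar> > 2 * a}"
    proof -
      have "{\<omega>\<in>A. \<bar>I t \<omega>\<bar> > 2 * a} = A \<inter> {\<omega>\<in>space M. \<bar>I t \<omega>\<bar> > 2 * a}"
        using sets.sets_into_space[OF A] by auto
      then have [measurable]: "{\<omega>\<in>A. \<bar>I t \<omega>\<bar> > 2 * a} \<in> sets M" by simp
      show ?thesis by (subst nn_integral_add) (auto simp: emeasure_space_1)
    qed
    also have "emeasure M {\<omega>\<in>A. \<bar>I t \<omega>\<bar> > 2 * a} \<le> ennreal (4 * b / a\<^sup>2)"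
    proof -
      have "prob {\<omega>\<in>A. \<bar>I t \<omega>\<bar> > 2 * a} \<le> 4 * b / a\<^sup>2"
        using Ab sets.sets_into_space[OF A] by (intro ito_integral_tail[OF W I t a b]) auto
      then show ?thesis unfolding emeasure_eq_measure by (rule ennreal_leI)
    qed
    finally show ?thesis using a b by (simp add: ennreal_plus add_left_mono)
  qed
  have "(\<integral>\<^sup>+\<omega>\<in>A. (\<integral>\<^sup>+t\<in>{0..T}. ennreal (min ((I t \<omega>)\<^sup>2) 1) \<partial>lborel) \<partial>M)
      = (\<integral>\<^sup>+\<omega>. (\<integral>\<^sup>+t. ennreal (min ((I t \<omega>)\<^sup>2) 1) * indicator A \<omega> \<partial>?Q) \<partial>M)"
  proof (rule nn_integral_cong)
    fix \<omega> assume \<omega>: "\<omega> \<in> space M"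
    have "(\<lambda>t. I t \<omega>) \<in> borel_measurable ?Q" using \<omega> by measurable
    then show "(\<integral>\<^sup>+t\<in>{0..T}. ennreal (min ((I t \<omega>)\<^sup>2) 1) \<partial>lborel) * indicator A \<omega>
        = (\<integral>\<^sup>+t. ennreal (min ((I t \<omega>)\<^sup>2) 1) * indicator A \<omega> \<partial>?Q)"
      by (subst nn_integral_multc) (auto simp: nn_integral_restrict_space)
  qed
  also have "\<dots> = (\<integral>\<^sup>+t. (\<integral>\<^sup>+\<omega>\<in>A. ennreal (min ((I t \<omega>)\<^sup>2) 1) \<partial>M) \<partial>?Q)"
    by (rule MQ.Fubini'[symmetric]) measurable
  also have "\<dots> \<le> (\<integral>\<^sup>+t. ennreal (4 * a\<^sup>2 + 4 * b / a\<^sup>2) \<partial>?Q)"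
    using pt by (intro nn_integral_mono) (auto simp: space_restrict_space)
  also have "\<dots> = ennreal (T * (4 * a\<^sup>2 + 4 * b / a\<^sup>2))"
    using T a b by (simp add: emeasure_restrict_space ennreal_mult' mult.commute)
  finally show ?thesis .
qed

lemma set_nn_integral_continuous:
  fixes f :: "real \<Rightarrow> real"
  assumes "continuous_on {a..b} f" "\<And>t. t \<in> {a..b} \<Longrightarrow> f t \<ge> 0"
  shows "(\<integral>\<^sup>+t\<in>{a..b}. ennreal (f t) \<partial>lborel) = ennreal (integral {a..b} f)"
proof -
  have int: "integrable lborel (\<lambda>t. indicator {a..b} t * f t)"
    using borel_integrable_atLeastAtMost'[OF assms(1)] by (simp add: set_integrable_def)
  have "(\<integral>\<^sup>+t\<in>{a..b}. ennreal (f t) \<partial>lborel) = (\<integral>\<^sup>+t. ennreal (indicator {a..b} t * f t) \<partial>lborel)"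
    by (intro nn_integral_cong) (auto simp: indicator_def)
  also have "\<dots> = ennreal (LINT t|lborel. indicator {a..b} t * f t)"
    using assms(2) by (intro nn_integral_eq_integral[OF int] AE_I2) (auto simp: indicator_def)
  also have "(LINT t|lborel. indicator {a..b} t * f t) = integral {a..b} f"
    using set_lebesgue_integral_continuous[OF assms(1)] by (simp add: set_lebesgue_integral_def)
  finally show ?thesis .
qed

text \<open>The solution can stay near the unperturbed path only if the Ito integral makes up for the gap
  \<open>\<kappa>\<close> between the two drifts, although its quadratic variation is \<open>O(\<epsilon>\<^sup>2)\<close> there.\<close>

lemma sde_near_unperturbed_path:
  fixes S S0 \<sigma> xs :: "real \<Rightarrow> real"
  assumes sde: "sde_solution M F T W S (\<lambda>x. \<epsilon> * \<sigma> x) x0 X"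
    and T: "T > 0" and \<epsilon>: "0 < \<epsilon>" "\<epsilon> \<le> 1" and K: "K \<ge> 0" and L: "L > 0" and B: "B > 0" and \<kappa>: "\<kappa> > 0"
    and lipS: "\<And>x y. \<bar>S x - S y\<bar> \<le> L * \<bar>x - y\<bar>" and lip\<sigma>: "\<And>x y. \<bar>\<sigma> x - \<sigma> y\<bar> \<le> L * \<bar>x - y\<bar>"
    and cS0: "continuous_on UNIV S0" and cxs: "continuous_on {0..T} xs"
    and xs: "\<And>t. t \<in> {0..T} \<Longrightarrow> xs t = x0 + integral {0..t} (\<lambda>s. S0 (xs s))"
    and \<sigma>B: "\<And>t. t \<in> {0..T} \<Longrightarrow> (\<sigma> (xs t))\<^sup>2 \<le> B"
    and gap: "\<kappa> \<le> integral {0..T} (\<lambda>t. min ((integral {0..t} (\<lambda>s. S (xs s) - S0 (xs s)))\<^sup>2) 1)"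
    and small: "(3 * K + 3 * T * (L * (T + K) / 2)\<^sup>2) * \<epsilon>\<^sup>2 \<le> \<kappa> / 2"
  shows "measure M {\<omega>\<in>space M. (LINT t:{0..T}|lborel. (X t \<omega> - xs t)\<^sup>2) \<le> K * \<epsilon>\<^sup>2}
    \<le> 24 * T * (1 + 2 * T * B + 2 * L\<^sup>2 * K) / \<kappa> * \<epsilon>" (is "measure M ?A \<le> _")
proof -
  have W: "wiener_process_wrt M F T W" using sde by (simp add: sde_solution_def)
  then have wp: "wiener_process M T W" and sub: "\<And>t. subalgebra M (F t)" by (auto simp: wiener_process_wrt_def)
  interpret prob_space M using wp by (simp add: wiener_process_def)
  have Xcont: "\<And>\<omega>. \<omega> \<in> space M \<Longrightarrow> continuous_on {0..T} (\<lambda>t. X t \<omega>)"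
    and XF: "\<And>t. t \<in> {0..T} \<Longrightarrow> X t \<in> borel_measurable (F t)"
    using sde by (auto simp: sde_solution_def)
  have XM: "X t \<in> borel_measurable M" if "t \<in> {0..T}" for t
    using measurable_from_subalg[OF sub XF[OF that]] .
  obtain I where I: "is_ito_integral M F T W (\<lambda>t \<omega>. \<epsilon> * \<sigma> (X t \<omega>)) I"
    and eq: "AE \<omega> in M. \<forall>t\<in>{0..T}. X t \<omega> = x0 + (LINT s:{0..t}|lborel. S (X s \<omega>)) + I t \<omega>"
    using sde unfolding sde_solution_def by blast
  have Icont: "\<And>\<omega>. \<omega> \<in> space M \<Longrightarrow> continuous_on {0..T} (\<lambda>t. I t \<omega>)"
    using I by (simp add: is_ito_integral_def)
  have cS: "continuous_on UNIV S" and c\<sigma>: "continuous_on UNIV \<sigma>"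
    using L lipS lip\<sigma> by (auto intro!: lipschitz_on_continuous_on[of L] lipschitz_onI simp: dist_real_def)
  have cSX: "continuous_on {0..T} (\<lambda>t. S (X t \<omega>))" and c\<sigma>X: "continuous_on {0..T} (\<lambda>t. \<sigma> (X t \<omega>))"
    if "\<omega> \<in> space M" for \<omega>
    using continuous_on_compose2[OF cS Xcont[OF that]] continuous_on_compose2[OF c\<sigma> Xcont[OF that]] by auto
  have c\<sigma>xs: "continuous_on {0..T} (\<lambda>t. \<sigma> (xs t))"
    using continuous_on_compose2[OF c\<sigma> cxs] by auto
  have near: "integral {0..T} (\<lambda>t. (X t \<omega> - xs t)\<^sup>2) \<le> K * \<epsilon>\<^sup>2" and \<omega>M: "\<omega> \<in> space M"
    if "\<omega> \<in> ?A" for \<omega>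
  proof -
    show \<omega>: "\<omega> \<in> space M" using that by simp
    have "continuous_on {0..T} (\<lambda>t. (X t \<omega> - xs t)\<^sup>2)"
      by (intro continuous_intros Xcont \<omega> cxs)
    then show "integral {0..T} (\<lambda>t. (X t \<omega> - xs t)\<^sup>2) \<le> K * \<epsilon>\<^sup>2"
      using that by (simp add: set_lebesgue_integral_continuous)
  qed
  have A[measurable]: "?A \<in> sets M"
  proof -
    have "(\<lambda>(t, \<omega>). X t \<omega> - xs t) \<in> borel_measurable (restrict_space borel {0..T} \<Otimes>\<^sub>M M)"
      using XM Xcont cxs T by (intro continuous_process_jointly_measurable) (auto intro!: continuous_intros)
    then have "(\<lambda>(t, \<omega>). (X t \<omega> - xs t)\<^sup>2) \<in> borel_measurable (restrict_space borel {0..T} \<Otimes>\<^sub>M M)"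
      unfolding case_prod_beta by measurable
    note [measurable] = borel_measurable_set_integral_time[OF this]
    show ?thesis by measurable
  qed
  define b where "b = (2 * T * B + 2 * L\<^sup>2 * K) * \<epsilon>\<^sup>2"
  have b: "b > 0" using T B L K \<epsilon> by (auto simp: b_def intro!: mult_pos_pos add_pos_nonneg)
  have qv: "(\<integral>\<^sup>+s\<in>{0..T}. ennreal ((\<epsilon> * \<sigma> (X s \<omega>))\<^sup>2) \<partial>lborel) \<le> ennreal b" if \<omega>: "\<omega> \<in> ?A" for \<omega>
  proof -
    have "integral {0..T} (\<lambda>s. (\<epsilon> * \<sigma> (X s \<omega>))\<^sup>2)
        \<le> integral {0..T} (\<lambda>s. \<epsilon>\<^sup>2 * (2 * B + 2 * L\<^sup>2 * (X s \<omega> - xs s)\<^sup>2))"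
    proof (intro integral_le integrable_continuous_interval continuous_intros c\<sigma>X Xcont \<omega>M[OF \<omega>] cxs)
      fix s assume s: "s \<in> {0..T}"
      have "(\<sigma> (X s \<omega>))\<^sup>2 \<le> 2 * (\<sigma> (xs s))\<^sup>2 + 2 * (\<sigma> (X s \<omega>) - \<sigma> (xs s))\<^sup>2"
        using zero_le_power2[of "\<sigma> (X s \<omega>) - 2 * \<sigma> (xs s)"] by (simp add: power2_eq_square algebra_simps)
      moreover have "(\<sigma> (X s \<omega>) - \<sigma> (xs s))\<^sup>2 \<le> L\<^sup>2 * (X s \<omega> - xs s)\<^sup>2"
        using power2_le_of_abs_le[OF lip\<sigma>] by (simp add: power_mult_distrib)
      ultimately have "(\<sigma> (X s \<omega>))\<^sup>2 \<le> 2 * B + 2 * L\<^sup>2 * (X s \<omega> - xs s)\<^sup>2"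
        using \<sigma>B[OF s] by linarith
      then show "(\<epsilon> * \<sigma> (X s \<omega>))\<^sup>2 \<le> \<epsilon>\<^sup>2 * (2 * B + 2 * L\<^sup>2 * (X s \<omega> - xs s)\<^sup>2)"
        by (simp add: power_mult_distrib mult_left_mono)
    qed
    also have "\<dots> = \<epsilon>\<^sup>2 * (T * (2 * B) + 2 * L\<^sup>2 * integral {0..T} (\<lambda>s. (X s \<omega> - xs s)\<^sup>2))"
      using T \<omega>M[OF \<omega>]
      by (subst integral_mult_right, subst Henstock_Kurzweil_Integration.integral_add)
        (auto intro!: integrable_continuous_interval continuous_intros Xcont cxs)
    also have "\<dots> \<le> \<epsilon>\<^sup>2 * (T * (2 * B) + 2 * L\<^sup>2 * (K * \<epsilon>\<^sup>2))"
      using near[OF \<omega>] by (intro mult_left_mono add_left_mono) auto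
    also have "\<dots> \<le> \<epsilon>\<^sup>2 * (T * (2 * B) + 2 * L\<^sup>2 * (K * 1))"
      using \<epsilon> K by (intro mult_left_mono add_left_mono) (auto simp: power_le_one)
    also have "\<dots> = b" by (simp add: b_def algebra_simps)
    finally have "integral {0..T} (\<lambda>s. (\<epsilon> * \<sigma> (X s \<omega>))\<^sup>2) \<le> b" .
    then show ?thesis
      by (subst set_nn_integral_continuous) (auto intro!: continuous_intros c\<sigma>X \<omega>M[OF \<omega>] ennreal_leI)
  qed
  have "ennreal (\<kappa> / 6 * prob ?A) = (\<integral>\<^sup>+\<omega>. ennreal (\<kappa> / 6) * indicator ?A \<omega> \<partial>M)"
    using \<kappa> by (simp add: nn_integral_cmult_indicator emeasure_eq_measure flip: ennreal_mult)
  also have "\<dots> \<le> (\<integral>\<^sup>+\<omega>\<in>?A. (\<integral>\<^sup>+t\<in>{0..T}. ennreal (min ((I t \<omega>)\<^sup>2) 1) \<partial>lborel) \<partial>M)"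
  proof (rule nn_integral_mono_AE)
    show "AE \<omega> in M. ennreal (\<kappa> / 6) * indicator ?A \<omega>
        \<le> (\<integral>\<^sup>+t\<in>{0..T}. ennreal (min ((I t \<omega>)\<^sup>2) 1) \<partial>lborel) * indicator ?A \<omega>"
      using eq
    proof eventually_elim
      case (elim \<omega>)
      have "ennreal (\<kappa> / 6) \<le> (\<integral>\<^sup>+t\<in>{0..T}. ennreal (min ((I t \<omega>)\<^sup>2) 1) \<partial>lborel)" if \<omega>: "\<omega> \<in> ?A"
      proof -
        have X: "X t \<omega> = x0 + integral {0..t} (\<lambda>s. S (X s \<omega>)) + I t \<omega>" if t: "t \<in> {0..T}" for t
        proof -
          have "continuous_on {0..t} (\<lambda>s. S (X s \<omega>))"
            using t by (intro continuous_on_subset[OF cSX[OF \<omega>M[OF \<omega>]]]) auto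
          then show ?thesis using elim t set_lebesgue_integral_continuous by fastforce
        qed
        from pathwise_lower_bound[OF T \<epsilon>(1) K L Xcont[OF \<omega>M[OF \<omega>]] Icont[OF \<omega>M[OF \<omega>]] cxs lipS cS0 X xs near[OF \<omega>]]
        have "\<kappa> / 6 \<le> integral {0..T} (\<lambda>t. min ((I t \<omega>)\<^sup>2) 1)" using gap small by simp
        then show ?thesis
          by (subst set_nn_integral_continuous)
            (auto intro!: continuous_intros Icont[OF \<omega>M[OF \<omega>]] ennreal_leI)
      qed
      then show ?case by (auto simp: indicator_def)
    qed
  qed
  \<comment> \<open>The level \<open>a = sqrt \<epsilon>\<close> balances \<open>a\<^sup>2\<close> against \<open>b / a\<^sup>2\<close>, as \<open>b\<close> is of order \<open>\<epsilon>\<^sup>2\<close>; both are then \<open>O(\<epsilon>)\<close>.\<close>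
  also have "\<dots> \<le> ennreal (T * (4 * (sqrt \<epsilon>)\<^sup>2 + 4 * b / (sqrt \<epsilon>)\<^sup>2))"
    using \<epsilon> by (intro ito_integral_truncated_square[OF W I T _ b A qv]) auto
  also have "T * (4 * (sqrt \<epsilon>)\<^sup>2 + 4 * b / (sqrt \<epsilon>)\<^sup>2) = 4 * T * (1 + 2 * T * B + 2 * L\<^sup>2 * K) * \<epsilon>"
    using \<epsilon> by (simp add: b_def power2_eq_square field_simps)
  finally have "\<kappa> / 6 * prob ?A \<le> 4 * T * (1 + 2 * T * B + 2 * L\<^sup>2 * K) * \<epsilon>"
    using T B L K \<epsilon> by (subst (asm) ennreal_le_iff) auto
  then show ?thesis using \<kappa> by (simp add: field_simps)
qed

section \<open>A deterministic shift of a Wiener path\<close>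

lemma (in prob_space) upper_tail_tendsto_0:
  fixes Q :: "'a \<Rightarrow> real"
  assumes Q: "Q \<in> borel_measurable M"
  shows "((\<lambda>R. prob {\<omega>\<in>space M. Q \<omega> > R}) \<longlongrightarrow> 0) at_top"
proof -
  interpret D: real_distribution "distr M borel Q" using Q by (intro real_distribution_distr)
  have "prob {\<omega>\<in>space M. Q \<omega> > R} = 1 - cdf (distr M borel Q) R" for R
  proof -
    have "prob {\<omega>\<in>space M. Q \<omega> > R} = prob (space M - {\<omega>\<in>space M. Q \<omega> \<le> R})"
      by (intro arg_cong[where f = prob]) auto
    also have "\<dots> = 1 - prob {\<omega>\<in>space M. Q \<omega> \<le> R}" using Q by (intro prob_compl) measurable
    also have "prob {\<omega>\<in>space M. Q \<omega> \<le> R} = cdf (distr M borel Q) R"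
      unfolding cdf_def using Q by (subst measure_distr) (auto intro!: arg_cong[where f = prob])
    finally show ?thesis .
  qed
  then show ?thesis using tendsto_diff[OF tendsto_const[of 1] D.cdf_lim_at_top_prob] by simp
qed

text \<open>The shifted path can have small norm only if the path itself is about as large as the shift:
  \<open>H\<^sup>2 \<le> 2 (H + w)\<^sup>2 + 2 w\<^sup>2\<close>.\<close>

lemma shifted_process_power:
  fixes w :: "real \<Rightarrow> 'b \<Rightarrow> real" and R c :: real
  assumes N: "prob_space N"
    and wM: "\<And>t. t \<in> {0..1} \<Longrightarrow> w t \<in> borel_measurable N"
    and wcont: "\<And>\<omega>. \<omega> \<in> space N \<Longrightarrow> continuous_on {0..1} (\<lambda>t. w t \<omega>)"
    and H: "continuous_on {0..1} H" and R: "2 * (R + c) < integral {0..1} (\<lambda>v. (H v)\<^sup>2)"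
  shows "1 - measure N {\<omega>\<in>space N. (LINT v:{0..1}|lborel. (H v + w v \<omega>)\<^sup>2) > c}
    \<le> measure N {\<omega>\<in>space N. (LINT v:{0..1}|lborel. (w v \<omega>)\<^sup>2) > R}"
proof -
  interpret prob_space N by (rule N)
  have meas: "(\<lambda>\<omega>. LINT v:{0..1}|lborel. (f v + w v \<omega>)\<^sup>2) \<in> borel_measurable N"
    if f: "continuous_on {0..1} f" for f
  proof -
    have "(\<lambda>(t, \<omega>). f t + w t \<omega>) \<in> borel_measurable (restrict_space borel {0..1} \<Otimes>\<^sub>M N)"
      using wM wcont f by (intro continuous_process_jointly_measurable) (auto intro!: continuous_intros)
    then have "(\<lambda>(t, \<omega>). (f t + w t \<omega>)\<^sup>2) \<in> borel_measurable (restrict_space borel {0..1} \<Otimes>\<^sub>M N)"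
      unfolding case_prod_beta by measurable
    then show ?thesis by (rule borel_measurable_set_integral_time)
  qed
  note [measurable] = meas[OF H] meas[OF continuous_on_const[of _ 0], simplified]
  have "1 - prob {\<omega>\<in>space N. (LINT v:{0..1}|lborel. (H v + w v \<omega>)\<^sup>2) > c}
      = prob (space N - {\<omega>\<in>space N. (LINT v:{0..1}|lborel. (H v + w v \<omega>)\<^sup>2) > c})"
    by (intro prob_compl[symmetric]) measurable
  also have "\<dots> \<le> prob {\<omega>\<in>space N. (LINT v:{0..1}|lborel. (w v \<omega>)\<^sup>2) > R}"
  proof (rule finite_measure_mono)
    show "space N - {\<omega>\<in>space N. (LINT v:{0..1}|lborel. (H v + w v \<omega>)\<^sup>2) > c}
        \<subseteq> {\<omega>\<in>space N. (LINT v:{0..1}|lborel. (w v \<omega>)\<^sup>2) > R}"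
    proof safe
      fix \<omega> assume \<omega>: "\<omega> \<in> space N" and c: "\<not> c < (LINT v:{0..1}|lborel. (H v + w v \<omega>)\<^sup>2)"
      note cw = wcont[OF \<omega>]
      have "integral {0..1} (\<lambda>v. (H v)\<^sup>2) \<le> integral {0..1} (\<lambda>v. 2 * (H v + w v \<omega>)\<^sup>2 + 2 * (w v \<omega>)\<^sup>2)"
      proof (intro integral_le integrable_continuous_interval continuous_intros H cw)
        fix v
        show "(H v)\<^sup>2 \<le> 2 * (H v + w v \<omega>)\<^sup>2 + 2 * (w v \<omega>)\<^sup>2"
          using zero_le_power2[of "H v + 2 * w v \<omega>"] by (simp add: power2_eq_square algebra_simps)
      qed
      also have "\<dots> = 2 * integral {0..1} (\<lambda>v. (H v + w v \<omega>)\<^sup>2) + 2 * integral {0..1} (\<lambda>v. (w v \<omega>)\<^sup>2)"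
        by (subst Henstock_Kurzweil_Integration.integral_add)
          (auto intro!: integrable_continuous_interval continuous_intros H cw)
      finally have "integral {0..1} (\<lambda>v. (H v)\<^sup>2)
          \<le> 2 * integral {0..1} (\<lambda>v. (H v + w v \<omega>)\<^sup>2) + 2 * integral {0..1} (\<lambda>v. (w v \<omega>)\<^sup>2)" .
      moreover have "(LINT v:{0..1}|lborel. (H v + w v \<omega>)\<^sup>2) = integral {0..1} (\<lambda>v. (H v + w v \<omega>)\<^sup>2)"
        "(LINT v:{0..1}|lborel. (w v \<omega>)\<^sup>2) = integral {0..1} (\<lambda>v. (w v \<omega>)\<^sup>2)"
        by (intro set_lebesgue_integral_continuous continuous_intros H cw)+
      ultimately show "R < (LINT v:{0..1}|lborel. (w v \<omega>)\<^sup>2)" using R c by argo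
    qed
  qed measurable
  finally show ?thesis .
qed

section \<open>The noise-free flow and its change of variable\<close>

text \<open>At the last time before \<open>t\<^sub>1\<close> at which the path is not below its initial value it equals that value,
  and there its derivative is positive, which pushes it above again.\<close>

lemma autonomous_flow_ge_initial:
  fixes xs f :: "real \<Rightarrow> real"
  assumes der: "\<And>t. t \<in> {0..T} \<Longrightarrow> (xs has_real_derivative f (xs t)) (at t within {0..T})"
    and pos: "f (xs 0) > 0" and t1: "t\<^sub>1 \<in> {0..T}"
  shows "xs t\<^sub>1 \<ge> xs 0"
proof (rule ccontr)
  assume less: "\<not> xs 0 \<le> xs t\<^sub>1"
  have "continuous_on {0..T} xs" using der by (rule DERIV_continuous_on)
  then have cont: "continuous_on {0..t\<^sub>1} xs" using t1 by (elim continuous_on_subset) auto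
  define Z where "Z = {t\<in>{0..t\<^sub>1}. xs 0 \<le> xs t}"
  have "closed Z" unfolding Z_def
    by (rule continuous_on_closed_Collect_le[OF continuous_on_const cont closed_atLeastAtMost])
  moreover have "bounded Z" unfolding Z_def by (rule bounded_subset[of "{0..t\<^sub>1}"]) auto
  ultimately have "compact Z" by (simp add: compact_eq_bounded_closed)
  moreover have "0 \<in> Z" using t1 by (simp add: Z_def)
  ultimately obtain s where s: "s \<in> Z" "\<And>t. t \<in> Z \<Longrightarrow> t \<le> s"
    using compact_attains_sup[of Z] by blast
  have s01: "0 \<le> s" "s < t\<^sub>1" "xs 0 \<le> xs s" using s(1) less by (auto simp: Z_def less_le)
  obtain t where "s \<le> t" "t \<le> t\<^sub>1" "xs t = xs 0"
    using IVT2'[of xs t\<^sub>1 "xs 0" s] s01 less continuous_on_subset[OF cont] by force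
  with s(2)[of t] s01 have "xs s = xs 0" by (auto simp: Z_def)
  then obtain d where d: "d > 0" "\<And>h. h > 0 \<Longrightarrow> s + h \<in> {0..T} \<Longrightarrow> h < d \<Longrightarrow> xs s < xs (s + h)"
    using has_real_derivative_pos_inc_right[OF der[of s]] pos s01 t1 by auto
  define h where "h = min (d / 2) (t\<^sub>1 - s)"
  have h: "h > 0" "h < d" "s + h \<le> t\<^sub>1" using d(1) s01 by (auto simp: h_def)
  then have "xs s < xs (s + h)" using s01 t1 by (intro d) auto
  then have "s + h \<in> Z" using h s01 by (auto simp: Z_def)
  with s(2)[of "s + h"] h show False by simp
qed

text \<open>The data of the problem that do not depend on \<open>\<epsilon>\<close>.\<close>

locale noise_free_flow =
  fixes T L x0 :: real and S0 \<sigma> xs :: "real \<Rightarrow> real"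
  assumes T: "T > 0" and L: "L > 0"
    and \<sigma>_pos: "\<And>x. (\<sigma> x)\<^sup>2 > 0"
    and lip: "\<And>x y. \<bar>S0 x - S0 y\<bar> + \<bar>\<sigma> x - \<sigma> y\<bar> \<le> L * \<bar>x - y\<bar>"
    and R: "condition_R x0 S0 \<sigma>"
    and xs_0: "xs 0 = x0"
    and xs_deriv: "\<And>t. t \<in> {0..T} \<Longrightarrow> (xs has_real_derivative S0 (xs t)) (at t within {0..T})"
begin

lemma S0_pos: "x \<ge> x0 \<Longrightarrow> S0 x > 0" using R by (simp add: condition_R_def)
lemma \<sigma>_nz: "\<sigma> x \<noteq> 0" using \<sigma>_pos[of x] by auto
lemma lip_S0: "\<bar>S0 x - S0 y\<bar> \<le> L * \<bar>x - y\<bar>" using lip[of x y] by linarith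
lemma lip_\<sigma>: "\<bar>\<sigma> x - \<sigma> y\<bar> \<le> L * \<bar>x - y\<bar>" using lip[of x y] by linarith

lemma continuous_S0: "continuous_on A S0"
  using L lip_S0 by (auto intro!: lipschitz_on_continuous_on[of L] lipschitz_onI simp: dist_real_def)

lemma continuous_\<sigma>: "continuous_on A \<sigma>"
  using L lip_\<sigma> by (auto intro!: lipschitz_on_continuous_on[of L] lipschitz_onI simp: dist_real_def)

lemma continuous_xs: "continuous_on {0..T} xs" using xs_deriv by (rule DERIV_continuous_on)

lemma continuous_S0_xs: "continuous_on {0..T} (\<lambda>t. S0 (xs t))"
  by (rule continuous_on_compose2[OF continuous_S0[of UNIV] continuous_xs]) simp

lemma continuous_\<sigma>_xs: "continuous_on {0..T} (\<lambda>t. \<sigma> (xs t))"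
  by (rule continuous_on_compose2[OF continuous_\<sigma>[of UNIV] continuous_xs]) simp

lemma xs_ge: "t \<in> {0..T} \<Longrightarrow> xs t \<ge> x0"
  using autonomous_flow_ge_initial[of T xs S0 t, OF xs_deriv] S0_pos[of x0] xs_0 by simp

lemma S0_xs_pos: "t \<in> {0..T} \<Longrightarrow> S0 (xs t) > 0" using S0_pos xs_ge by simp

lemma xs_increment:
  assumes "0 \<le> s" "s \<le> t" "t \<le> T"
  shows "xs t - xs s = integral {s..t} (\<lambda>t. S0 (xs t))"
proof -
  have "((\<lambda>t. S0 (xs t)) has_integral (xs t - xs s)) {s..t}"
  proof (rule fundamental_theorem_of_calculus[OF assms(2)])
    fix q assume "q \<in> {s..t}"
    then have "(xs has_real_derivative S0 (xs q)) (at q within {s..t})"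
      using assms by (intro DERIV_subset[OF xs_deriv]) auto
    then show "(xs has_vector_derivative S0 (xs q)) (at q within {s..t})"
      by (simp add: has_real_derivative_iff_has_vector_derivative)
  qed
  then show ?thesis by (rule integral_unique[symmetric])
qed

lemma xs_eq: "t \<in> {0..T} \<Longrightarrow> xs t = x0 + integral {0..t} (\<lambda>s. S0 (xs s))"
  using xs_increment[of 0 t] xs_0 by simp

lemma xs_mem: assumes "t \<in> {0..T}" shows "xs t \<in> {x0..xs T}"
proof -
  have "0 \<le> integral {t..T} (\<lambda>t. S0 (xs t))"
    using assms S0_xs_pos
    by (intro integral_nonneg integrable_continuous_interval continuous_on_subset[OF continuous_S0_xs])
      (auto intro: less_imp_le)
  then show ?thesis using xs_increment[of t T] assms xs_ge[OF assms] by simp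
qed

lemma x0_less_xs_T: "x0 < xs T"
  using integral_continuous_pos[OF T continuous_S0_xs S0_xs_pos] xs_eq[of T] T by simp

definition u where "u = u_fun S0 \<sigma> x0"
text \<open>The point \<open>x(u\<^sub>T s)\<close> of the path at which \<open>h\<^sub>*(s)\<close> evaluates \<open>h\<close>.\<close>

definition state where "state s = the_inv_into {x0..xs T} u (u (xs T) * s)"

lemma continuous_u_density: "continuous_on {x0..xs T} (\<lambda>y. (\<sigma> y)\<^sup>2 / (S0 y)^3)"
  using S0_pos by (intro continuous_intros continuous_S0 continuous_\<sigma>) force

lemma u_eq: assumes "x \<in> {x0..xs T}" shows "u x = integral {x0..x} (\<lambda>y. (\<sigma> y)\<^sup>2 / (S0 y)^3)"
  unfolding u_def u_fun_def using assms
  by (intro set_lebesgue_integral_continuous continuous_on_subset[OF continuous_u_density]) auto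

text \<open>The density \<open>\<sigma>\<^sup>2 / S\<^sub>0\<^sup>3\<close> is bounded away from zero on the range of the path. This makes \<open>u\<close> invertible
  and its inverse Lipschitz.\<close>

lemma u_expanding: obtains m where "m > 0"
  "\<And>a b. x0 \<le> a \<Longrightarrow> a \<le> b \<Longrightarrow> b \<le> xs T \<Longrightarrow> m * (b - a) \<le> u b - u a"
proof -
  let ?\<psi> = "\<lambda>y. (\<sigma> y)\<^sup>2 / (S0 y)^3"
  obtain m where m: "m > 0" "\<And>y. y \<in> {x0..xs T} \<Longrightarrow> m \<le> ?\<psi> y"
    using positive_continuous_lower_bound[OF _ continuous_u_density] x0_less_xs_T S0_pos \<sigma>_pos
    by (metis atLeastAtMost_iff divide_pos_pos less_imp_le zero_less_power)
  show thesis
  proof (rule that[OF m(1)])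
    fix a b assume ab: "x0 \<le> a" "a \<le> b" "b \<le> xs T"
    have "integral {x0..a} ?\<psi> + integral {a..b} ?\<psi> = integral {x0..b} ?\<psi>"
      using ab by (intro Henstock_Kurzweil_Integration.integral_combine integrable_continuous_interval
          continuous_on_subset[OF continuous_u_density]) auto
    then have "u b - u a = integral {a..b} ?\<psi>" using ab u_eq[of a] u_eq[of b] by simp
    moreover have "integral {a..b} (\<lambda>_. m) \<le> integral {a..b} ?\<psi>"
      using ab m(2) by (intro integral_le integrable_continuous_interval
          continuous_on_subset[OF continuous_u_density]) auto
    ultimately show "m * (b - a) \<le> u b - u a" using ab by (simp add: mult.commute)
  qed
qed

lemma u_x0: "u x0 = 0" using u_eq[of x0] x0_less_xs_T by simp

lemma u_strict_mono: "strict_mono_on {x0..xs T} u"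
proof (rule strict_mono_onI)
  fix a b assume ab: "a \<in> {x0..xs T}" "b \<in> {x0..xs T}" "a < b"
  obtain m where "m > 0" "\<And>a b. x0 \<le> a \<Longrightarrow> a \<le> b \<Longrightarrow> b \<le> xs T \<Longrightarrow> m * (b - a) \<le> u b - u a"
    using u_expanding by metis
  with ab have "0 < m * (b - a)" "m * (b - a) \<le> u b - u a" by auto
  then show "u a < u b" by linarith
qed

lemma u_inj: "inj_on u {x0..xs T}" using u_strict_mono by (rule strict_mono_on_imp_inj_on)

lemma u_T_pos: "u (xs T) > 0"
  using strict_mono_onD[OF u_strict_mono, of x0 "xs T"] x0_less_xs_T u_x0 by simp

lemma state_mem: assumes s: "s \<in> {0..1}" shows "state s \<in> {x0..xs T}" "u (state s) = u (xs T) * s"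
proof -
  have "continuous_on {x0..xs T} u"
    using indefinite_integral_continuous_1[OF integrable_continuous_interval[OF continuous_u_density]]
    by (rule continuous_on_eq) (simp add: u_eq)
  moreover have "u x0 \<le> u (xs T) * s" "u (xs T) * s \<le> u (xs T)"
    using s u_T_pos u_x0 by (auto simp: mult_le_cancel_left1)
  ultimately have "u (xs T) * s \<in> u ` {x0..xs T}"
    using IVT'[of u x0 "u (xs T) * s" "xs T"] x0_less_xs_T by force
  then show "state s \<in> {x0..xs T}" "u (state s) = u (xs T) * s"
    unfolding state_def using the_inv_into_into[OF u_inj _ subset_refl] f_the_inv_into_f[OF u_inj] by simp_all
qed

lemma state_onto: assumes x: "x \<in> {x0..xs T}" obtains s where "s \<in> {0..1}" "state s = x"
proof (rule that)
  show "u x / u (xs T) \<in> {0..1}"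
    using x u_T_pos strict_mono_on_leD[OF u_strict_mono, of x0 x] strict_mono_on_leD[OF u_strict_mono, of x "xs T"]
      x0_less_xs_T u_x0 by auto
  show "state (u x / u (xs T)) = x"
    unfolding state_def using u_T_pos the_inv_into_f_f[OF u_inj x] by simp
qed

lemma state_lipschitz: obtains C where "C > 0"
  "\<And>s s'. s \<in> {0..1} \<Longrightarrow> s' \<in> {0..1} \<Longrightarrow> \<bar>state s - state s'\<bar> \<le> C * \<bar>s - s'\<bar>"
proof -
  obtain m where m: "m > 0" "\<And>a b. x0 \<le> a \<Longrightarrow> a \<le> b \<Longrightarrow> b \<le> xs T \<Longrightarrow> m * (b - a) \<le> u b - u a"
    using u_expanding by metis
  have "\<bar>state s - state s'\<bar> \<le> u (xs T) / m * \<bar>s - s'\<bar>" if "s \<in> {0..1}" "s' \<in> {0..1}" for s s'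
  proof -
    have "m * \<bar>state s - state s'\<bar> \<le> \<bar>u (state s) - u (state s')\<bar>"
      using m(2)[of "state s" "state s'"] m(2)[of "state s'" "state s"] state_mem(1)[OF that(1)] state_mem(1)[OF that(2)]
      by (cases "state s \<le> state s'") (auto simp: abs_if)
    also have "\<dots> = u (xs T) * \<bar>s - s'\<bar>"
      using state_mem(2)[OF that(1)] state_mem(2)[OF that(2)] u_T_pos by (simp add: abs_mult flip: right_diff_distrib)
    finally show ?thesis using m(1) by (simp add: field_simps)
  qed
  then show thesis using m(1) u_T_pos by (intro that[of "u (xs T) / m"]) auto
qed

text \<open>The factor that turns the shift of the trend into \<open>\<epsilon> h\<close>; it carries no \<open>\<epsilon>\<close>.\<close>

definition \<phi> where "\<phi> x = S0 x / (\<sigma> x)\<^sup>2"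

lemma \<phi>_lipschitz: obtains C where "C > 0"
  "\<And>x x'. x \<in> {x0..xs T} \<Longrightarrow> x' \<in> {x0..xs T} \<Longrightarrow> \<bar>\<phi> x - \<phi> x'\<bar> \<le> C * \<bar>x - x'\<bar>"
proof -
  obtain S0' where S0': "\<And>x. (S0 has_real_derivative S0' x) (at x)" "continuous_on UNIV S0'"
    using R unfolding condition_R_def by blast
  obtain \<sigma>' where \<sigma>': "\<And>x. (\<sigma> has_real_derivative \<sigma>' x) (at x)" "continuous_on UNIV \<sigma>'"
    using R unfolding condition_R_def by blast
  define \<phi>' where "\<phi>' x = (S0' x * (\<sigma> x)\<^sup>2 - S0 x * (2 * \<sigma> x * \<sigma>' x)) / ((\<sigma> x)\<^sup>2 * (\<sigma> x)\<^sup>2)" for x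
  have d: "(\<phi> has_real_derivative \<phi>' x) (at x)" for x
    unfolding \<phi>_def \<phi>'_def using \<sigma>_nz
    by (auto intro!: derivative_eq_intros S0' \<sigma>')
  have "continuous_on {x0..xs T} \<phi>'"
    unfolding \<phi>'_def using \<sigma>_nz
    by (intro continuous_intros continuous_S0 continuous_\<sigma> continuous_on_subset[OF S0'(2)]
        continuous_on_subset[OF \<sigma>'(2)]) auto
  then have "bounded (\<phi>' ` {x0..xs T})" by (intro compact_imp_bounded compact_continuous_image) auto
  then obtain C where C: "C > 0" "\<And>x. x \<in> {x0..xs T} \<Longrightarrow> \<bar>\<phi>' x\<bar> \<le> C"
    unfolding bounded_pos by auto
  show thesis
  proof (rule that[OF C(1)])
    fix x x' assume "x \<in> {x0..xs T}" "x' \<in> {x0..xs T}"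
    then have "norm (\<phi> x - \<phi> x') \<le> C * norm (x - x')"
      using C(2) d by (intro field_differentiable_bound[of "{x0..xs T}" \<phi> \<phi>'])
        (auto intro: has_field_derivative_at_within)
    then show "\<bar>\<phi> x - \<phi> x'\<bar> \<le> C * \<bar>x - x'\<bar>" by simp
  qed
qed

lemma xs_lipschitz: obtains C where "C > 0"
  "\<And>s t. s \<in> {0..T} \<Longrightarrow> t \<in> {0..T} \<Longrightarrow> \<bar>xs s - xs t\<bar> \<le> C * \<bar>s - t\<bar>"
proof -
  have "bounded ((\<lambda>t. S0 (xs t)) ` {0..T})"
    by (intro compact_imp_bounded compact_continuous_image continuous_S0_xs) auto
  then obtain C where C: "C > 0" "\<And>t. t \<in> {0..T} \<Longrightarrow> \<bar>S0 (xs t)\<bar> \<le> C"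
    unfolding bounded_pos by auto
  show thesis
  proof (rule that[OF C(1)])
    fix s t assume "s \<in> {0..T}" "t \<in> {0..T}"
    then have "norm (xs s - xs t) \<le> C * norm (s - t)"
      using C(2) xs_deriv by (intro field_differentiable_bound[of "{0..T}" xs "\<lambda>t. S0 (xs t)"]) auto
    then show "\<bar>xs s - xs t\<bar> \<le> C * \<bar>s - t\<bar>" by simp
  qed
qed

section \<open>Every alternative moves the trend by a fixed amount\<close>

text \<open>The shift has order one: \<open>h\<close> is of order \<open>1 / \<epsilon>\<close>, and the factor \<open>\<epsilon>\<close> is absorbed here.\<close>

definition shift where "shift \<epsilon> h x = trend S0 \<sigma> \<epsilon> h x - S0 x"

lemma trend_lipschitz:
  assumes "admissible L S \<sigma>"
  shows "\<bar>S x - S x'\<bar> \<le> L * \<bar>x - x'\<bar>"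
proof -
  have "\<bar>S x - S x'\<bar> + \<bar>\<sigma> x - \<sigma> x'\<bar> \<le> L * \<bar>x - x'\<bar>" using assms by (simp add: admissible_def)
  then show ?thesis by simp
qed

lemma trend_growth:
  assumes "admissible L S \<sigma>"
  shows "\<bar>S x\<bar> \<le> L * (1 + \<bar>x\<bar>)"
proof -
  have "\<bar>S x\<bar> + \<bar>\<sigma> x\<bar> \<le> L * (1 + \<bar>x\<bar>)" using assms by (simp add: admissible_def)
  then show ?thesis using abs_ge_zero[of "\<sigma> x"] by linarith
qed

text \<open>The constant is the same for all \<open>\<epsilon>\<close> and \<open>h\<close>, which is where the uniformity over the alternatives starts.\<close>

lemma shift_lipschitz:
  assumes "admissible L (trend S0 \<sigma> \<epsilon> h) \<sigma>"
  shows "\<bar>shift \<epsilon> h x - shift \<epsilon> h x'\<bar> \<le> 2 * L * \<bar>x - x'\<bar>"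
proof -
  have "\<bar>shift \<epsilon> h x - shift \<epsilon> h x'\<bar> \<le> \<bar>trend S0 \<sigma> \<epsilon> h x - trend S0 \<sigma> \<epsilon> h x'\<bar> + \<bar>S0 x - S0 x'\<bar>"
    unfolding shift_def by simp
  also have "\<dots> \<le> L * \<bar>x - x'\<bar> + L * \<bar>x - x'\<bar>"
    by (intro add_mono trend_lipschitz[OF assms] lip_S0)
  finally show ?thesis by simp
qed

lemma continuous_shift:
  assumes "admissible L (trend S0 \<sigma> \<epsilon> h) \<sigma>"
  shows "continuous_on A (shift \<epsilon> h)"
  using L shift_lipschitz[OF assms]
  by (auto intro!: lipschitz_on_continuous_on[of "2 * L"] lipschitz_onI simp: dist_real_def)

text \<open>A function whose mean square over \<open>[0, T]\<close> is at least \<open>r\<^sup>2 / T\<close> attains \<open>r / sqrt T\<close> somewhere.\<close>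

lemma alternative_point:
  assumes r: "r > 0" and \<epsilon>: "\<epsilon> > 0" and alt: "h \<in> alternatives T S0 \<sigma> xs r \<epsilon>"
    and adm: "admissible L (trend S0 \<sigma> \<epsilon> h) \<sigma>"
  obtains t where "t \<in> {0..T}" "r / sqrt T \<le> \<bar>shift \<epsilon> h (xs t)\<bar>"
proof -
  have cg: "continuous_on {0..T} (\<lambda>t. shift \<epsilon> h (xs t))"
    by (rule continuous_on_compose2[OF continuous_shift[OF adm, of UNIV] continuous_xs]) simp
  have "(\<lambda>t. (h (xs t) * (\<sigma> (xs t))\<^sup>2 / S0 (xs t))\<^sup>2) = (\<lambda>t. (shift \<epsilon> h (xs t) / \<epsilon>)\<^sup>2)"
    using \<epsilon> by (simp add: shift_def trend_def)
  then have "r / \<epsilon> \<le> sqrt (LINT t:{0..T}|lborel. (shift \<epsilon> h (xs t) / \<epsilon>)\<^sup>2)"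
    using alt by (simp add: alternatives_def L2_norm_on_def)
  also have "(LINT t:{0..T}|lborel. (shift \<epsilon> h (xs t) / \<epsilon>)\<^sup>2) = integral {0..T} (\<lambda>t. (shift \<epsilon> h (xs t) / \<epsilon>)\<^sup>2)"
    using \<epsilon> by (intro set_lebesgue_integral_continuous continuous_intros cg) auto
  also have "\<dots> = integral {0..T} (\<lambda>t. (shift \<epsilon> h (xs t))\<^sup>2) / \<epsilon>\<^sup>2"
    by (simp add: power_divide)
  finally have "r / \<epsilon> \<le> sqrt (integral {0..T} (\<lambda>t. (shift \<epsilon> h (xs t))\<^sup>2)) / \<epsilon>"
    using \<epsilon> by (simp add: real_sqrt_divide)
  then have "r \<le> sqrt (integral {0..T} (\<lambda>t. (shift \<epsilon> h (xs t))\<^sup>2))"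
    using \<epsilon> by (simp add: divide_le_cancel)
  then have "r\<^sup>2 \<le> integral {0..T} (\<lambda>t. (shift \<epsilon> h (xs t))\<^sup>2)"
    using r real_le_rsqrt by (metis less_imp_le real_sqrt_le_iff real_sqrt_unique)
  then have "T * (r / sqrt T)\<^sup>2 \<le> integral {0..T} (\<lambda>t. (shift \<epsilon> h (xs t))\<^sup>2)"
    using T by (simp add: power_divide)
  then show thesis
    using exists_large_value[OF T cg] r T that by (metis divide_nonneg_nonneg less_imp_le real_sqrt_ge_zero)
qed

lemma trend_gap:
  assumes r: "r > 0"
  obtains \<kappa> where "\<kappa> > 0"
    "\<And>\<epsilon> h. \<epsilon> > 0 \<Longrightarrow> h \<in> alternatives T S0 \<sigma> xs r \<epsilon> \<Longrightarrow> admissible L (trend S0 \<sigma> \<epsilon> h) \<sigma> \<Longrightarrow>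
      \<kappa> \<le> integral {0..T} (\<lambda>t. min ((integral {0..t} (\<lambda>s. shift \<epsilon> h (xs s)))\<^sup>2) 1)"
proof -
  obtain C where C: "C > 0" "\<And>s t. s \<in> {0..T} \<Longrightarrow> t \<in> {0..T} \<Longrightarrow> \<bar>xs s - xs t\<bar> \<le> C * \<bar>s - t\<bar>"
    using xs_lipschitz by metis
  have pos: "2 * L * C > 0" "r / sqrt T > 0" using L C T r by auto
  obtain \<kappa> where \<kappa>: "\<kappa> > 0"
    "\<And>f t\<^sub>0. (\<And>x y. x \<in> {0..T} \<Longrightarrow> y \<in> {0..T} \<Longrightarrow> \<bar>f x - f y\<bar> \<le> 2 * L * C * \<bar>x - y\<bar>) \<Longrightarrow>
      t\<^sub>0 \<in> {0..T} \<Longrightarrow> r / sqrt T \<le> \<bar>f t\<^sub>0\<bar> \<Longrightarrow>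
      \<kappa> \<le> integral {0..T} (\<lambda>t. min ((integral {0..t} f)\<^sup>2) (1::real))"
    using primitive_bounded_below[OF T pos] by metis
  show thesis
  proof (rule that[OF \<kappa>(1)])
    fix \<epsilon> h assume \<epsilon>: "\<epsilon> > 0" and alt: "h \<in> alternatives T S0 \<sigma> xs r \<epsilon>"
      and adm: "admissible L (trend S0 \<sigma> \<epsilon> h) \<sigma>"
    obtain t where t: "t \<in> {0..T}" "r / sqrt T \<le> \<bar>shift \<epsilon> h (xs t)\<bar>"
      using alternative_point[OF r \<epsilon> alt adm] .
    show "\<kappa> \<le> integral {0..T} (\<lambda>t. min ((integral {0..t} (\<lambda>s. shift \<epsilon> h (xs s)))\<^sup>2) 1)"
    proof (rule \<kappa>(2)[of "\<lambda>s. shift \<epsilon> h (xs s)", OF _ t])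
      fix s t assume st: "s \<in> {0..T}" "t \<in> {0..T}"
      have "\<bar>shift \<epsilon> h (xs s) - shift \<epsilon> h (xs t)\<bar> \<le> 2 * L * \<bar>xs s - xs t\<bar>" by (rule shift_lipschitz[OF adm])
      also have "\<dots> \<le> 2 * L * (C * \<bar>s - t\<bar>)" using C(2)[OF st] L by (intro mult_left_mono) auto
      finally show "\<bar>shift \<epsilon> h (xs s) - shift \<epsilon> h (xs t)\<bar> \<le> 2 * L * C * \<bar>s - t\<bar>" by (simp add: mult.assoc)
    qed
  qed
qed

text \<open>Writing \<open>h\<close> through the shift exhibits \<open>\<epsilon> h\<^sub>*\<close> as a function whose size and Lipschitz constant can be
  bounded without reference to \<open>\<epsilon>\<close>.\<close>

lemma scaled_h_star:
  assumes \<epsilon>: "\<epsilon> > 0" and s: "s \<in> {0..1}"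
  shows "\<epsilon> * h_star T S0 \<sigma> xs x0 h s = sqrt (u (xs T)) * (shift \<epsilon> h (state s) * \<phi> (state s))"
proof -
  have "S0 (state s) > 0" using S0_pos state_mem[OF s] by simp
  then show ?thesis
    using \<epsilon> \<sigma>_nz[of "state s"] by (simp add: h_star_def Let_def shift_def \<phi>_def trend_def state_def u_def)
qed

text \<open>The point of the path where the shift is large corresponds to a rescaled time at which \<open>\<epsilon> h\<^sub>*\<close> is
  large, and \<open>\<epsilon> h\<^sub>*\<close> is Lipschitz as a product of bounded Lipschitz functions composed with a
  Lipschitz one. The growth bound of the alternatives is what makes the shift bounded uniformly.\<close>

lemma h_star_gap:
  assumes r: "r > 0"
  obtains \<kappa> where "\<kappa> > 0"
    "\<And>\<epsilon> h. \<epsilon> > 0 \<Longrightarrow> h \<in> alternatives T S0 \<sigma> xs r \<epsilon> \<Longrightarrow> admissible L (trend S0 \<sigma> \<epsilon> h) \<sigma> \<Longrightarrow>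
      continuous_on {0..1} (h_star T S0 \<sigma> xs x0 h) \<and>
      \<kappa> / \<epsilon>\<^sup>2 \<le> integral {0..1} (\<lambda>v. (integral {0..v} (h_star T S0 \<sigma> xs x0 h))\<^sup>2)"
proof -
  let ?D = "{x0..xs T}" and ?w = "sqrt (u (xs T))"
  obtain Cy where Cy: "Cy > 0" "\<And>s s'. s \<in> {0..1} \<Longrightarrow> s' \<in> {0..1} \<Longrightarrow> \<bar>state s - state s'\<bar> \<le> Cy * \<bar>s - s'\<bar>"
    using state_lipschitz by metis
  obtain C\<phi> where C\<phi>: "C\<phi> > 0" "\<And>x x'. x \<in> ?D \<Longrightarrow> x' \<in> ?D \<Longrightarrow> \<bar>\<phi> x - \<phi> x'\<bar> \<le> C\<phi> * \<bar>x - x'\<bar>"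
    using \<phi>_lipschitz by metis
  have c\<phi>: "continuous_on ?D \<phi>" unfolding \<phi>_def
    using \<sigma>_nz by (intro continuous_intros continuous_S0 continuous_\<sigma>) auto
  have \<phi>_pos: "\<phi> x > 0" if "x \<in> ?D" for x using that S0_pos \<sigma>_pos by (simp add: \<phi>_def)
  obtain m where m: "m > 0" "\<And>x. x \<in> ?D \<Longrightarrow> m \<le> \<phi> x"
    using positive_continuous_lower_bound[OF _ c\<phi> \<phi>_pos] x0_less_xs_T by auto
  have "bounded (\<phi> ` ?D)" by (intro compact_imp_bounded compact_continuous_image c\<phi>) auto
  then obtain B\<phi> where B\<phi>: "B\<phi> > 0" "\<And>x. x \<in> ?D \<Longrightarrow> \<bar>\<phi> x\<bar> \<le> B\<phi>" unfolding bounded_pos by auto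
  have "bounded (S0 ` ?D)" by (intro compact_imp_bounded compact_continuous_image continuous_S0) auto
  then obtain B0 where B0: "B0 > 0" "\<And>x. x \<in> ?D \<Longrightarrow> \<bar>S0 x\<bar> \<le> B0" unfolding bounded_pos by auto
  define Bg where "Bg = L * (1 + (\<bar>x0\<bar> + \<bar>xs T\<bar>)) + B0"
  have Bg: "Bg > 0" using L B0 by (auto simp: Bg_def intro!: add_nonneg_pos)
  define \<Lambda> where "\<Lambda> = ?w * ((2 * L * B\<phi> + Bg * C\<phi>) * Cy)"
  define \<rho> where "\<rho> = ?w * (r / sqrt T * m)"
  have "\<Lambda> > 0" using u_T_pos L B\<phi> Bg C\<phi> Cy by (auto simp: \<Lambda>_def intro!: mult_pos_pos add_pos_pos)
  moreover have "\<rho> > 0" using u_T_pos r T m by (auto simp: \<rho>_def intro!: mult_pos_pos)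
  ultimately obtain \<kappa> where \<kappa>: "\<kappa> > 0"
    "\<And>f t\<^sub>0. (\<And>x y. x \<in> {0..1} \<Longrightarrow> y \<in> {0..1} \<Longrightarrow> \<bar>f x - f y\<bar> \<le> \<Lambda> * \<bar>x - y\<bar>) \<Longrightarrow>
      t\<^sub>0 \<in> {0..1} \<Longrightarrow> \<rho> \<le> \<bar>f t\<^sub>0\<bar> \<Longrightarrow>
      \<kappa> \<le> integral {0..1} (\<lambda>t. min ((integral {0..t} f)\<^sup>2) (1::real))"
    using primitive_bounded_below[OF zero_less_one] by metis
  show thesis
  proof (rule that[OF \<kappa>(1)])
    fix \<epsilon> h assume \<epsilon>: "\<epsilon> > 0" and alt: "h \<in> alternatives T S0 \<sigma> xs r \<epsilon>"
      and adm: "admissible L (trend S0 \<sigma> \<epsilon> h) \<sigma>"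
    let ?hs = "h_star T S0 \<sigma> xs x0 h"
    define f where "f s = \<epsilon> * ?hs s" for s
    have f_eq: "f s = ?w * (shift \<epsilon> h (state s) * \<phi> (state s))" if "s \<in> {0..1}" for s
      unfolding f_def using scaled_h_star[OF \<epsilon> that] .
    have shift_le: "\<bar>shift \<epsilon> h x\<bar> \<le> Bg" if x: "x \<in> ?D" for x
    proof -
      have "\<bar>trend S0 \<sigma> \<epsilon> h x\<bar> \<le> L * (1 + \<bar>x\<bar>)" by (rule trend_growth[OF adm])
      also have "\<dots> \<le> L * (1 + (\<bar>x0\<bar> + \<bar>xs T\<bar>))" using x L by (intro mult_left_mono add_left_mono) auto
      finally show ?thesis using B0(2)[OF x] unfolding shift_def Bg_def by linarith
    qed
    have lipf: "\<bar>f s - f s'\<bar> \<le> \<Lambda> * \<bar>s - s'\<bar>" if s: "s \<in> {0..1}" "s' \<in> {0..1}" for s s'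
    proof -
      note D = state_mem(1)[OF s(1)] state_mem(1)[OF s(2)]
      let ?G = "shift \<epsilon> h (state s)" and ?G' = "shift \<epsilon> h (state s')" and ?d = "\<bar>state s - state s'\<bar>"
      have "\<bar>?G * \<phi> (state s) - ?G' * \<phi> (state s')\<bar> = \<bar>(?G - ?G') * \<phi> (state s) + ?G' * (\<phi> (state s) - \<phi> (state s'))\<bar>"
        by (simp add: algebra_simps)
      also have "\<dots> \<le> \<bar>?G - ?G'\<bar> * \<bar>\<phi> (state s)\<bar> + \<bar>?G'\<bar> * \<bar>\<phi> (state s) - \<phi> (state s')\<bar>"
        using abs_triangle_ineq[of "(?G - ?G') * \<phi> (state s)" "?G' * (\<phi> (state s) - \<phi> (state s'))"] by (simp add: abs_mult)
      also have "\<dots> \<le> (2 * L * ?d) * B\<phi> + Bg * (C\<phi> * ?d)"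
        using L Bg D by (intro add_mono mult_mono shift_lipschitz[OF adm] B\<phi>(2) C\<phi>(2) shift_le) auto
      also have "\<dots> = (2 * L * B\<phi> + Bg * C\<phi>) * ?d" by (simp add: algebra_simps)
      also have "\<dots> \<le> (2 * L * B\<phi> + Bg * C\<phi>) * (Cy * \<bar>s - s'\<bar>)"
        using Cy(2)[OF s] L B\<phi>(1) Bg C\<phi>(1) by (intro mult_left_mono) auto
      finally have "?w * \<bar>?G * \<phi> (state s) - ?G' * \<phi> (state s')\<bar> \<le> ?w * ((2 * L * B\<phi> + Bg * C\<phi>) * (Cy * \<bar>s - s'\<bar>))"
        using u_T_pos by (intro mult_left_mono) auto
      moreover have "\<bar>f s - f s'\<bar> = ?w * \<bar>?G * \<phi> (state s) - ?G' * \<phi> (state s')\<bar>"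
        using u_T_pos by (simp add: f_eq[OF s(1)] f_eq[OF s(2)] abs_mult flip: right_diff_distrib)
      ultimately show ?thesis by (simp add: \<Lambda>_def mult.assoc)
    qed
    have "\<Lambda>-lipschitz_on {0..1} f"
      using lipf \<open>\<Lambda> > 0\<close> by (intro lipschitz_onI) (auto simp: dist_real_def)
    then have cf: "continuous_on {0..1} f" by (rule lipschitz_on_continuous_on)
    have f_fun: "f = (\<lambda>s. \<epsilon> * ?hs s)" by (simp add: f_def fun_eq_iff)
    have hs_eq: "?hs = (\<lambda>s. f s / \<epsilon>)" using \<epsilon> by (simp add: f_def fun_eq_iff)
    have ch: "continuous_on {0..1} ?hs" unfolding hs_eq using \<epsilon> by (intro continuous_intros cf) auto
    obtain t where t: "t \<in> {0..T}" "r / sqrt T \<le> \<bar>shift \<epsilon> h (xs t)\<bar>"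
      using alternative_point[OF r \<epsilon> alt adm] .
    obtain s where s: "s \<in> {0..1}" "state s = xs t" using state_onto[OF xs_mem[OF t(1)]] .
    have "r / sqrt T * m \<le> \<bar>shift \<epsilon> h (xs t)\<bar> * \<phi> (xs t)"
      using t(2) m(2)[OF xs_mem[OF t(1)]] m(1) by (intro mult_mono) auto
    then have "\<rho> \<le> ?w * (\<bar>shift \<epsilon> h (xs t)\<bar> * \<phi> (xs t))"
      unfolding \<rho>_def using u_T_pos by (intro mult_left_mono) auto
    also have "\<dots> = \<bar>f s\<bar>"
      using f_eq[OF s(1)] s(2) u_T_pos \<phi>_pos[OF xs_mem[OF t(1)]] by (simp add: abs_mult)
    finally have "\<kappa> \<le> integral {0..1} (\<lambda>t. min ((integral {0..t} f)\<^sup>2) 1)"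
      using \<kappa>(2)[OF lipf s(1)] by blast
    also have "\<dots> \<le> integral {0..1} (\<lambda>t. (integral {0..t} f)\<^sup>2)"
      by (intro integral_le integrable_continuous_interval continuous_intros
          indefinite_integral_continuous_1 cf) auto
    also have "\<dots> = integral {0..1} (\<lambda>t. \<epsilon>\<^sup>2 * (integral {0..t} ?hs)\<^sup>2)"
      unfolding f_fun by (simp add: power_mult_distrib)
    also have "\<dots> = \<epsilon>\<^sup>2 * integral {0..1} (\<lambda>t. (integral {0..t} ?hs)\<^sup>2)" by simp
    finally show "continuous_on {0..1} ?hs \<and> \<kappa> / \<epsilon>\<^sup>2 \<le> integral {0..1} (\<lambda>v. (integral {0..v} ?hs)\<^sup>2)"
      using ch \<epsilon> by (simp add: field_simps)
  qed
qed

section \<open>Convergence of the powers to one\<close>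

lemma limit_power_tendsto_1:
  fixes w :: "real \<Rightarrow> 'b \<Rightarrow> real" and h :: "real \<Rightarrow> real \<Rightarrow> real"
  assumes r: "r > 0" and w: "wiener_process N 1 w"
    and alt: "\<forall>\<^sub>F \<epsilon> in at_right 0. h \<epsilon> \<in> alternatives T S0 \<sigma> xs r \<epsilon>"
    and adm: "\<forall>\<^sub>F \<epsilon> in at_right 0. admissible L (trend S0 \<sigma> \<epsilon> (h \<epsilon>)) \<sigma>"
  shows "((\<lambda>\<epsilon>. measure N {\<omega>\<in>space N. (LINT v:{0..1}|lborel.
      ((LINT s:{0..v}|lborel. h_star T S0 \<sigma> xs x0 (h \<epsilon>) s) + w v \<omega>)\<^sup>2) > c}) \<longlongrightarrow> 1) (at_right 0)"
    (is "(?P \<longlongrightarrow> 1) _")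
proof -
  have N: "prob_space N"
    and wM: "\<And>t. t \<in> {0..1} \<Longrightarrow> w t \<in> borel_measurable N"
    and wcont: "\<And>\<omega>. \<omega> \<in> space N \<Longrightarrow> continuous_on {0..1} (\<lambda>t. w t \<omega>)"
    using w unfolding wiener_process_def by blast+
  interpret N: prob_space N by (rule N)
  obtain \<kappa> where \<kappa>: "\<kappa> > 0"
    "\<And>\<epsilon> h. \<epsilon> > 0 \<Longrightarrow> h \<in> alternatives T S0 \<sigma> xs r \<epsilon> \<Longrightarrow> admissible L (trend S0 \<sigma> \<epsilon> h) \<sigma> \<Longrightarrow>
      continuous_on {0..1} (h_star T S0 \<sigma> xs x0 h) \<and>
      \<kappa> / \<epsilon>\<^sup>2 \<le> integral {0..1} (\<lambda>v. (integral {0..v} (h_star T S0 \<sigma> xs x0 h))\<^sup>2)"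
    using h_star_gap[OF r] by metis
  \<comment> \<open>Chosen so that \<open>2 (R \<epsilon> + c) < \<kappa> / \<epsilon>\<^sup>2\<close> strictly, and tending to infinity as \<open>\<epsilon>\<close> decreases to \<open>0\<close>.\<close>
  define R where "R \<epsilon> = - (c + 1) + \<kappa> / 2 * (inverse \<epsilon>)\<^sup>2" for \<epsilon> :: real
  define tail where "tail R = measure N {\<omega>\<in>space N. (LINT v:{0..1}|lborel. (w v \<omega>)\<^sup>2) > R}" for R
  have bound: "1 - ?P \<epsilon> \<le> tail (R \<epsilon>)"
    if \<epsilon>: "\<epsilon> > 0" and alt: "h \<epsilon> \<in> alternatives T S0 \<sigma> xs r \<epsilon>"
      and adm: "admissible L (trend S0 \<sigma> \<epsilon> (h \<epsilon>)) \<sigma>" for \<epsilon>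
  proof -
    let ?hs = "h_star T S0 \<sigma> xs x0 (h \<epsilon>)"
    define H where "H v = (LINT s:{0..v}|lborel. ?hs s)" for v
    have hs: "continuous_on {0..1} ?hs" using \<kappa>(2)[OF \<epsilon> alt adm] by simp
    have H: "H v = integral {0..v} ?hs" if "v \<in> {0..1}" for v
      unfolding H_def using that by (intro set_lebesgue_integral_continuous continuous_on_subset[OF hs]) auto
    have cH: "continuous_on {0..1} H"
      using indefinite_integral_continuous_1[OF integrable_continuous_interval[OF hs]]
      by (rule continuous_on_eq) (simp add: H)
    have "integral {0..1} (\<lambda>v. (H v)\<^sup>2) = integral {0..1} (\<lambda>v. (integral {0..v} ?hs)\<^sup>2)"
      by (intro integral_cong) (simp add: H)
    then have "\<kappa> / \<epsilon>\<^sup>2 \<le> integral {0..1} (\<lambda>v. (H v)\<^sup>2)" using \<kappa>(2)[OF \<epsilon> alt adm] by simp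
    moreover have "2 * (R \<epsilon> + c) < \<kappa> / \<epsilon>\<^sup>2"
    proof -
      have "\<kappa> / \<epsilon>\<^sup>2 = \<kappa> * (inverse \<epsilon>)\<^sup>2" using \<epsilon> by (simp add: power2_eq_square divide_inverse)
      then show ?thesis by (simp add: R_def)
    qed
    ultimately have "2 * (R \<epsilon> + c) < integral {0..1} (\<lambda>v. (H v)\<^sup>2)" by (rule less_le_trans[rotated])
    from shifted_process_power[OF N wM wcont cH this] show ?thesis
      unfolding H_def tail_def by simp
  qed
  have tail: "((\<lambda>\<epsilon>. 1 - tail (R \<epsilon>)) \<longlongrightarrow> 1) (at_right 0)"
  proof -
    have "(\<lambda>(t, \<omega>). (w t \<omega>)\<^sup>2) \<in> borel_measurable (restrict_space borel {0..1} \<Otimes>\<^sub>M N)"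
      by (intro continuous_process_jointly_measurable borel_measurable_power continuous_on_power wM wcont) auto
    then have "(tail \<longlongrightarrow> 0) at_top"
      unfolding tail_def by (intro N.upper_tail_tendsto_0 borel_measurable_set_integral_time)
    moreover have "filterlim R at_top (at_right 0)"
    proof -
      have "filterlim (\<lambda>\<epsilon>::real. (inverse \<epsilon>)\<^sup>2) at_top (at_right 0)"
        by (rule filterlim_pow_at_top[OF _ filterlim_inverse_at_top_right]) simp
      then have "filterlim (\<lambda>\<epsilon>. \<kappa> / 2 * (inverse \<epsilon>)\<^sup>2) at_top (at_right 0)"
        using \<kappa>(1) by (intro filterlim_tendsto_pos_mult_at_top[OF tendsto_const]) simp_all
      then have "filterlim (\<lambda>\<epsilon>. - (c + 1) + \<kappa> / 2 * (inverse \<epsilon>)\<^sup>2) at_top (at_right 0)"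
        by (rule filterlim_tendsto_add_at_top[OF tendsto_const])
      then show ?thesis by (simp only: R_def[abs_def])
    qed
    ultimately have "((\<lambda>\<epsilon>. tail (R \<epsilon>)) \<longlongrightarrow> 0) (at_right 0)" by (rule filterlim_compose)
    from tendsto_diff[OF tendsto_const[of 1] this] show ?thesis by simp
  qed
  show ?thesis
  proof (rule tendsto_sandwich[OF _ _ tail tendsto_const])
    show "\<forall>\<^sub>F \<epsilon> in at_right 0. 1 - tail (R \<epsilon>) \<le> ?P \<epsilon>"
      using alt adm eventually_at_right_less[of 0]
    proof eventually_elim
      case (elim \<epsilon>)
      with bound[of \<epsilon>] show ?case by linarith
    qed
    show "\<forall>\<^sub>F \<epsilon> in at_right 0. ?P \<epsilon> \<le> 1" by (intro always_eventually allI N.prob_le_1)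
  qed
qed

text \<open>The weight \<open>\<sigma>\<^sup>2 / S\<^sub>0\<^sup>4\<close> in the statistic is bounded away from zero along the compact path. The maximum
  covers thresholds \<open>c < 0\<close>.\<close>

lemma accepting_forces_near:
  obtains K where "K \<ge> 0"
    "\<And>\<epsilon> X. \<epsilon> > 0 \<Longrightarrow> continuous_on {0..T} X \<Longrightarrow> test_statistic T S0 \<sigma> xs \<epsilon> X \<le> c \<Longrightarrow>
      (LINT t:{0..T}|lborel. (X t - xs t)\<^sup>2) \<le> K * \<epsilon>\<^sup>2"
proof -
  let ?q = "\<lambda>t. (\<sigma> (xs t))\<^sup>2 / (S0 (xs t))^4"
  define D where "D = (LINT t:{0..T}|lborel. (\<sigma> (xs t) / S0 (xs t))\<^sup>2)"
  have nz: "S0 (xs t) \<noteq> 0" if "t \<in> {0..T}" for t using S0_xs_pos[OF that] by simp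
  have cD: "continuous_on {0..T} (\<lambda>t. (\<sigma> (xs t) / S0 (xs t))\<^sup>2)"
    using nz by (intro continuous_intros continuous_\<sigma>_xs continuous_S0_xs) auto
  have D: "D > 0"
    unfolding D_def set_lebesgue_integral_continuous[OF cD]
    using T cD nz \<sigma>_nz by (intro integral_continuous_pos) auto
  have cq: "continuous_on {0..T} ?q"
    using nz by (intro continuous_intros continuous_\<sigma>_xs continuous_S0_xs) auto
  obtain m where m: "m > 0" "\<And>t. t \<in> {0..T} \<Longrightarrow> m \<le> ?q t"
    using positive_continuous_lower_bound[OF _ cq] T S0_xs_pos \<sigma>_pos
    by (metis divide_pos_pos less_imp_le zero_less_power)
  show thesis
  proof (rule that)
    show "max 0 (c * D\<^sup>2 / m) \<ge> 0" by simp
    fix \<epsilon> :: real and X assume \<epsilon>: "\<epsilon> > 0" and X: "continuous_on {0..T} X"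
      and le: "test_statistic T S0 \<sigma> xs \<epsilon> X \<le> c"
    let ?Z = "\<lambda>t. ((X t - xs t) / (\<epsilon> * (S0 (xs t))\<^sup>2))\<^sup>2 * (\<sigma> (xs t))\<^sup>2"
    have cZ: "continuous_on {0..T} ?Z"
      using nz \<epsilon> by (intro continuous_intros X continuous_xs continuous_\<sigma>_xs continuous_S0_xs) auto
    have cX: "continuous_on {0..T} (\<lambda>t. (X t - xs t)\<^sup>2)" by (intro continuous_intros X continuous_xs)
    have "m / \<epsilon>\<^sup>2 * integral {0..T} (\<lambda>t. (X t - xs t)\<^sup>2) = integral {0..T} (\<lambda>t. m / \<epsilon>\<^sup>2 * (X t - xs t)\<^sup>2)"
      by simp
    also have "\<dots> \<le> integral {0..T} ?Z"
    proof (intro integral_le integrable_continuous_interval cZ continuous_on_mult cX continuous_on_const)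
      fix t assume "t \<in> {0..T}"
      then have "m / \<epsilon>\<^sup>2 * (X t - xs t)\<^sup>2 \<le> ?q t / \<epsilon>\<^sup>2 * (X t - xs t)\<^sup>2"
        using m(2) by (intro mult_right_mono divide_right_mono) auto
      also have "\<dots> = ?Z t" by (simp add: power_divide power_mult_distrib mult.commute flip: power_mult)
      finally show "m / \<epsilon>\<^sup>2 * (X t - xs t)\<^sup>2 \<le> ?Z t" .
    qed
    also have "\<dots> \<le> c * D\<^sup>2"
    proof -
      have stat: "test_statistic T S0 \<sigma> xs \<epsilon> X = integral {0..T} ?Z / D\<^sup>2"
        unfolding test_statistic_def set_lebesgue_integral_continuous[OF cZ] D_def[symmetric]
        by (simp add: power_int_minus field_simps)
      have "integral {0..T} ?Z / D\<^sup>2 \<le> c" using le unfolding stat .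
      then show ?thesis using D by (simp only: pos_divide_le_eq[OF zero_less_power])
    qed
    finally have "integral {0..T} (\<lambda>t. (X t - xs t)\<^sup>2) \<le> c * D\<^sup>2 / m * \<epsilon>\<^sup>2"
      using m(1) \<epsilon> by (simp add: field_simps)
    also have "\<dots> \<le> max 0 (c * D\<^sup>2 / m) * \<epsilon>\<^sup>2" by (intro mult_right_mono) auto
    finally show "(LINT t:{0..T}|lborel. (X t - xs t)\<^sup>2) \<le> max 0 (c * D\<^sup>2 / m) * \<epsilon>\<^sup>2"
      by (simp add: set_lebesgue_integral_continuous[OF cX])
  qed
qed

lemma test_power_tendsto_1:
  fixes c :: real and h :: "real \<Rightarrow> real \<Rightarrow> real" and M :: "real \<Rightarrow> 'a measure"
    and X :: "real \<Rightarrow> real \<Rightarrow> 'a \<Rightarrow> real"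
  assumes r: "r > 0"
    and alt: "\<forall>\<^sub>F \<epsilon> in at_right 0. h \<epsilon> \<in> alternatives T S0 \<sigma> xs r \<epsilon>"
    and adm: "\<forall>\<^sub>F \<epsilon> in at_right 0. admissible L (trend S0 \<sigma> \<epsilon> (h \<epsilon>)) \<sigma>"
    and sde: "\<forall>\<^sub>F \<epsilon> in at_right 0.
      sde_solution (M \<epsilon>) (F \<epsilon>) T (W \<epsilon>) (trend S0 \<sigma> \<epsilon> (h \<epsilon>)) (\<lambda>x. \<epsilon> * \<sigma> x) x0 (X \<epsilon>)"
  shows "((\<lambda>\<epsilon>. measure (M \<epsilon>) {\<omega>\<in>space (M \<epsilon>). test_statistic T S0 \<sigma> xs \<epsilon> (\<lambda>t. X \<epsilon> t \<omega>) > c})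
    \<longlongrightarrow> 1) (at_right 0)" (is "(?P \<longlongrightarrow> 1) _")
proof -
  obtain K where K: "K \<ge> 0"
    "\<And>\<epsilon> X. \<epsilon> > 0 \<Longrightarrow> continuous_on {0..T} X \<Longrightarrow> test_statistic T S0 \<sigma> xs \<epsilon> X \<le> c \<Longrightarrow>
      (LINT t:{0..T}|lborel. (X t - xs t)\<^sup>2) \<le> K * \<epsilon>\<^sup>2"
    using accepting_forces_near[of c] by blast
  obtain \<kappa> where \<kappa>: "\<kappa> > 0"
    "\<And>\<epsilon> h. \<epsilon> > 0 \<Longrightarrow> h \<in> alternatives T S0 \<sigma> xs r \<epsilon> \<Longrightarrow> admissible L (trend S0 \<sigma> \<epsilon> h) \<sigma> \<Longrightarrow>
      \<kappa> \<le> integral {0..T} (\<lambda>t. min ((integral {0..t} (\<lambda>s. shift \<epsilon> h (xs s)))\<^sup>2) 1)"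
    using trend_gap[OF r] by metis
  have "bounded ((\<lambda>t. (\<sigma> (xs t))\<^sup>2) ` {0..T})"
    by (intro compact_imp_bounded compact_continuous_image continuous_intros continuous_\<sigma>_xs) auto
  then obtain B where B: "B > 0" "\<And>t. t \<in> {0..T} \<Longrightarrow> (\<sigma> (xs t))\<^sup>2 \<le> B"
    unfolding bounded_pos by auto
  define C1 where "C1 = 3 * K + 3 * T * (L * (T + K) / 2)\<^sup>2"
  have C1: "C1 \<ge> 0" using K T by (simp add: C1_def)
  \<comment> \<open>Below \<open>\<epsilon>\<^sub>0\<close> the terms of order \<open>\<epsilon>\<^sup>2\<close> in the pathwise estimate use up at most half of \<open>\<kappa>\<close>.\<close>
  define \<epsilon>\<^sub>0 where "\<epsilon>\<^sub>0 = min 1 (\<kappa> / (2 * (C1 + 1)))"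
  have \<epsilon>\<^sub>0: "\<epsilon>\<^sub>0 > 0" using \<kappa>(1) C1 by (simp add: \<epsilon>\<^sub>0_def)
  define C where "C = 24 * T * (1 + 2 * T * B + 2 * L\<^sup>2 * K) / \<kappa>"
  have bound: "prob_space (M \<epsilon>) \<and> 1 - C * \<epsilon> \<le> ?P \<epsilon>"
    if \<epsilon>: "0 < \<epsilon>" "\<epsilon> < \<epsilon>\<^sub>0" and alt: "h \<epsilon> \<in> alternatives T S0 \<sigma> xs r \<epsilon>"
      and adm: "admissible L (trend S0 \<sigma> \<epsilon> (h \<epsilon>)) \<sigma>"
      and sde: "sde_solution (M \<epsilon>) (F \<epsilon>) T (W \<epsilon>) (trend S0 \<sigma> \<epsilon> (h \<epsilon>)) (\<lambda>x. \<epsilon> * \<sigma> x) x0 (X \<epsilon>)"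
    for \<epsilon>
  proof -
    have W: "wiener_process_wrt (M \<epsilon>) (F \<epsilon>) T (W \<epsilon>)" using sde by (simp add: sde_solution_def)
    then interpret prob_space "M \<epsilon>" unfolding wiener_process_wrt_def wiener_process_def by blast
    have sub: "\<And>t. subalgebra (M \<epsilon>) (F \<epsilon> t)" using W by (simp add: wiener_process_wrt_def)
    have X: "\<And>\<omega>. \<omega> \<in> space (M \<epsilon>) \<Longrightarrow> continuous_on {0..T} (\<lambda>t. X \<epsilon> t \<omega>)"
      and XM: "\<And>t. t \<in> {0..T} \<Longrightarrow> X \<epsilon> t \<in> borel_measurable (M \<epsilon>)"
      using sde measurable_from_subalg[OF sub] unfolding sde_solution_def by blast+
    have \<epsilon>1: "\<epsilon> \<le> 1" "\<epsilon> < \<kappa> / (2 * (C1 + 1))" using \<epsilon> by (auto simp: \<epsilon>\<^sub>0_def)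
    have small: "C1 * \<epsilon>\<^sup>2 \<le> \<kappa> / 2"
    proof -
      have "C1 * \<epsilon>\<^sup>2 \<le> (C1 + 1) * \<epsilon>"
        using \<epsilon> \<epsilon>1 C1 by (intro mult_mono) (auto simp: power2_eq_square mult_left_le)
      also have "\<dots> \<le> \<kappa> / 2" using \<epsilon>1(2) C1 by (simp add: field_simps)
      finally show ?thesis .
    qed
    let ?R = "{\<omega>\<in>space (M \<epsilon>). test_statistic T S0 \<sigma> xs \<epsilon> (\<lambda>t. X \<epsilon> t \<omega>) > c}"
    let ?A = "{\<omega>\<in>space (M \<epsilon>). (LINT t:{0..T}|lborel. (X \<epsilon> t \<omega> - xs t)\<^sup>2) \<le> K * \<epsilon>\<^sup>2}"
    have mR: "?R \<in> sets (M \<epsilon>)"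
    proof -
      have nz: "S0 (xs t) \<noteq> 0" if "t \<in> {0..T}" for t using S0_xs_pos[OF that] by simp
      have "(\<lambda>(t, \<omega>). ((X \<epsilon> t \<omega> - xs t) / (\<epsilon> * (S0 (xs t))\<^sup>2))\<^sup>2 * (\<sigma> (xs t))\<^sup>2)
          \<in> borel_measurable (restrict_space borel {0..T} \<Otimes>\<^sub>M M \<epsilon>)"
      proof (rule continuous_process_jointly_measurable[OF T])
        fix t assume "t \<in> {0..T}"
        note [measurable] = XM[OF this]
        show "(\<lambda>\<omega>. ((X \<epsilon> t \<omega> - xs t) / (\<epsilon> * (S0 (xs t))\<^sup>2))\<^sup>2 * (\<sigma> (xs t))\<^sup>2) \<in> borel_measurable (M \<epsilon>)"
          by measurable
      next
        fix \<omega> assume "\<omega> \<in> space (M \<epsilon>)"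
        from X[OF this] show "continuous_on {0..T} (\<lambda>t. ((X \<epsilon> t \<omega> - xs t) / (\<epsilon> * (S0 (xs t))\<^sup>2))\<^sup>2 * (\<sigma> (xs t))\<^sup>2)"
          using nz \<epsilon> by (intro continuous_intros continuous_xs continuous_\<sigma>_xs continuous_S0_xs) auto
      qed
      note [measurable] = borel_measurable_set_integral_time[OF this]
      show ?thesis unfolding test_statistic_def by measurable
    qed
    have mA: "?A \<in> sets (M \<epsilon>)"
    proof -
      have "(\<lambda>(t, \<omega>). (X \<epsilon> t \<omega> - xs t)\<^sup>2) \<in> borel_measurable (restrict_space borel {0..T} \<Otimes>\<^sub>M M \<epsilon>)"
        by (intro continuous_process_jointly_measurable[OF T] borel_measurable_power borel_measurable_diff
            borel_measurable_const continuous_on_power continuous_on_diff XM X continuous_xs)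
      note [measurable] = borel_measurable_set_integral_time[OF this]
      show ?thesis by measurable
    qed
    have "1 - prob ?R = prob (space (M \<epsilon>) - ?R)" using mR by (simp add: prob_compl)
    also have "\<dots> \<le> prob ?A"
      using K(2)[OF \<epsilon>(1) X] by (intro finite_measure_mono mA) (auto simp: not_less)
    also have "\<dots> \<le> C * \<epsilon>"
      using \<kappa>(2)[OF \<epsilon>(1) alt adm] small unfolding shift_def C1_def C_def
      by (intro sde_near_unperturbed_path[OF sde T \<epsilon>(1) \<epsilon>1(1) K(1) L B(1) \<kappa>(1) trend_lipschitz[OF adm]
            lip_\<sigma> continuous_S0 continuous_xs xs_eq B(2)]) auto
    finally show ?thesis using prob_space_axioms by simp
  qed
  have ev: "\<forall>\<^sub>F \<epsilon> in at_right 0. prob_space (M \<epsilon>) \<and> 1 - C * \<epsilon> \<le> ?P \<epsilon>"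
    using alt adm sde eventually_at_right_real[OF \<epsilon>\<^sub>0]
  proof eventually_elim
    case (elim \<epsilon>)
    then show ?case by (intro bound) auto
  qed
  have "((\<lambda>\<epsilon>. 1 - C * \<epsilon>) \<longlongrightarrow> 1 - C * 0) (at_right 0)" by (intro tendsto_intros)
  then have lower: "((\<lambda>\<epsilon>. 1 - C * \<epsilon>) \<longlongrightarrow> 1) (at_right 0)" by simp
  show ?thesis
  proof (rule tendsto_sandwich[OF _ _ lower tendsto_const])
    show "\<forall>\<^sub>F \<epsilon> in at_right 0. 1 - C * \<epsilon> \<le> ?P \<epsilon>" using ev by (rule eventually_mono) simp
    show "\<forall>\<^sub>F \<epsilon> in at_right 0. ?P \<epsilon> \<le> 1"
      using ev by (rule eventually_mono) (blast intro: prob_space.prob_le_1)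
  qed
qed

end

theorem proposition2:
  fixes T r \<alpha> L x0 c :: real
    and S0 \<sigma> xs :: "real \<Rightarrow> real"
    and h :: "real \<Rightarrow> real \<Rightarrow> real"
    and M :: "real \<Rightarrow> 'a measure"
    and F :: "real \<Rightarrow> real \<Rightarrow> 'a measure"
    and W X :: "real \<Rightarrow> real \<Rightarrow> 'a \<Rightarrow> real"
    and N :: "'b measure"
    and w :: "real \<Rightarrow> 'b \<Rightarrow> real"
  assumes "T > 0" and "r > 0" and "0 < \<alpha>" and "\<alpha> < 1" and "L > 0"
    and "\<And>x. (\<sigma> x)\<^sup>2 > 0"
    and "\<And>x y. \<bar>S0 x - S0 y\<bar> + \<bar>\<sigma> x - \<sigma> y\<bar> \<le> L * \<bar>x - y\<bar>"
    and "condition_R x0 S0 \<sigma>"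
    and "xs 0 = x0"
    and "\<And>t. t \<in> {0..T} \<Longrightarrow> (xs has_real_derivative S0 (xs t)) (at t within {0..T})"
    and "wiener_process N 1 w"
    and "measure N {\<omega>\<in>space N. (LINT v:{0..1}|lborel. (w v \<omega>)\<^sup>2) > c} = \<alpha>"
    and "\<forall>\<^sub>F \<epsilon> in at_right 0. h \<epsilon> \<in> alternatives T S0 \<sigma> xs r \<epsilon>"
    and "\<forall>\<^sub>F \<epsilon> in at_right 0. admissible L (trend S0 \<sigma> \<epsilon> (h \<epsilon>)) \<sigma>"
    and "\<forall>\<^sub>F \<epsilon> in at_right 0.
           sde_solution (M \<epsilon>) (F \<epsilon>) T (W \<epsilon>) (trend S0 \<sigma> \<epsilon> (h \<epsilon>)) (\<lambda>x. \<epsilon> * \<sigma> x) x0 (X \<epsilon>)"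
  shows "((\<lambda>\<epsilon>.
      measure (M \<epsilon>) {\<omega>\<in>space (M \<epsilon>). test_statistic T S0 \<sigma> xs \<epsilon> (\<lambda>t. X \<epsilon> t \<omega>) > c}
      - measure N {\<omega>\<in>space N.
          (LINT v:{0..1}|lborel.
             ((LINT s:{0..v}|lborel. h_star T S0 \<sigma> xs x0 (h \<epsilon>) s) + w v \<omega>)\<^sup>2) > c})
    \<longlongrightarrow> 0) (at_right 0)"
proof -
  interpret noise_free_flow T L x0 S0 \<sigma> xs using assms(1,5-10) by unfold_locales
  from tendsto_diff[OF test_power_tendsto_1[OF assms(2,13-15)] limit_power_tendsto_1[OF assms(2,11,13,14)]]
  show ?thesis by simp
qed

end
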